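(* Let $f:\mathbb{R}\to\mathbb{R}$ be a function which is zero only finitely often, is continuous on some interval, and has continuous derivative on that same interval. Define $B_f(t)$ as the function given by the stochastic integral $$B_f(t)=\int_0^t f(x)\,W(dx),$$ where $W$ is the one-dimensional Wiener process. Then almost surely $$\dim_{\mathrm{A}} G_{B_f}^{[0,1]}=2 .$$
   Context: Wiener process (Brownian motion): the stochastic process $W(t)$ with $W(0)=0$ almost surely, independent increments, and $W(t+h)-W(t)$ normally distributed with mean $0$ and variance $h$. The stochastic integral is interpreted as an Itô integral. Graph: for a function $X$ that is right continuous with left limits and $I\subset\mathbb{R}$, $G_X^{I}=\{(t,y): y=X(t),\ t\in I\}\cup J\subset\mathbb{R}^2$, where $J$ is the union of vertical segments joining the discontinuities ($J$ is empty if $X$ is continuous). Assouad dimension: a non-empty compact set $F\subset\mathbb{R}^2$ is $s$-homogeneous if there is a constant $C>0$ such that for all $R>0$, $r\in(0,R]$ and $x\in F$, $N(B(x,R)\cap F,r)\leq C(R/r)^s$, where $B(x,R)$ is the closed ball of centre $x$ and radius $R$ and $N(E,r)$ is the number of squares of the $r\times r$ grid that intersect $E$. Then $\dim_{\mathrm{A}}F=\inf\{s\geq 0: F\text{ is } s\text{-homogeneous}\}$. *)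

theory Defs
  imports "HOL-Probability.Probability"
begin

(* Time runs over [0,oo); the values of W at negative times are irrelevant. *)
definition wiener_process :: "'a measure \<Rightarrow> (real \<Rightarrow> 'a \<Rightarrow> real) \<Rightarrow> bool" where
  "wiener_process M W \<longleftrightarrow>
     prob_space M \<and>
     (\<forall>t\<ge>0. W t \<in> borel_measurable M) \<and>
     (AE \<omega> in M. W 0 \<omega> = 0) \<and>
     (\<forall>(n::nat) (t::nat \<Rightarrow> real). 0 \<le> t 0 \<and> (\<forall>i<n. t i < t (Suc i)) \<longrightarrow>
        prob_space.indep_vars M (\<lambda>_. borel) (\<lambda>i \<omega>. W (t (Suc i)) \<omega> - W (t i) \<omega>) {..<n}) \<and>
     (\<forall>t\<ge>0. \<forall>h>0. distributed M lborel (\<lambda>\<omega>. W (t + h) \<omega> - W t \<omega>) (normal_density 0 (sqrt h)))"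

definition natural_filtration :: "'a measure \<Rightarrow> (real \<Rightarrow> 'a \<Rightarrow> real) \<Rightarrow> real \<Rightarrow> 'a measure" where
  "natural_filtration M W s =
     sigma (space M) {W u -` A \<inter> space M | u A. u \<in> {0..s} \<and> A \<in> sets borel}"

(* The data (n, t, \<xi>) encode the process sum_{i<n} \<xi>_i 1_[t_i, t_{i+1}) on the time interval [0,T]. *)
definition elementary_integrand ::
  "'a measure \<Rightarrow> (real \<Rightarrow> 'a \<Rightarrow> real) \<Rightarrow> real \<Rightarrow> nat \<Rightarrow> (nat \<Rightarrow> real) \<Rightarrow> (nat \<Rightarrow> 'a \<Rightarrow> real) \<Rightarrow> bool" where
  "elementary_integrand M W T n t \<xi> \<longleftrightarrow>
     t 0 = 0 \<and> t n = T \<and> (\<forall>i<n. t i < t (Suc i)) \<and>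
     (\<forall>i<n. \<xi> i \<in> borel_measurable (natural_filtration M W (t i)) \<and>
            (\<exists>c. \<forall>\<omega>\<in>space M. \<bar>\<xi> i \<omega>\<bar> \<le> c))"

definition elementary_process ::
  "nat \<Rightarrow> (nat \<Rightarrow> real) \<Rightarrow> (nat \<Rightarrow> 'a \<Rightarrow> real) \<Rightarrow> real \<Rightarrow> 'a \<Rightarrow> real" where
  "elementary_process n t \<xi> x \<omega> = (\<Sum>i<n. \<xi> i \<omega> * indicator {t i..<t (Suc i)} x)"

definition elementary_integral ::
  "(real \<Rightarrow> 'a \<Rightarrow> real) \<Rightarrow> nat \<Rightarrow> (nat \<Rightarrow> real) \<Rightarrow> (nat \<Rightarrow> 'a \<Rightarrow> real) \<Rightarrow> 'a \<Rightarrow> real" where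
  "elementary_integral W n t \<xi> \<omega> = (\<Sum>i<n. \<xi> i \<omega> * (W (t (Suc i)) \<omega> - W (t i) \<omega>))"

definition ito_integrable ::
  "'a measure \<Rightarrow> (real \<Rightarrow> 'a \<Rightarrow> real) \<Rightarrow> real \<Rightarrow> (real \<Rightarrow> 'a \<Rightarrow> real) \<Rightarrow> bool" where
  "ito_integrable M W T H \<longleftrightarrow>
     (\<lambda>(x, \<omega>). H x \<omega>) \<in> borel_measurable (restrict_space borel {0..T} \<Otimes>\<^sub>M M) \<and>
     (\<forall>x\<in>{0..T}. H x \<in> borel_measurable (natural_filtration M W x)) \<and>
     (\<integral>\<^sup>+\<omega>. (\<integral>\<^sup>+x\<in>{0..T}. ennreal ((H x \<omega>)\<^sup>2) \<partial>lborel) \<partial>M) < \<infinity>"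

(* Y is a version of the Ito integral of H over [0,T] with respect to W: the L^2(M)-limit of the
   integrals of elementary processes converging to H in L^2([0,T] x M).  Such a Y is
   determined by H up to almost sure equality. *)
definition is_ito_integral ::
  "'a measure \<Rightarrow> (real \<Rightarrow> 'a \<Rightarrow> real) \<Rightarrow> real \<Rightarrow> (real \<Rightarrow> 'a \<Rightarrow> real) \<Rightarrow> ('a \<Rightarrow> real) \<Rightarrow> bool" where
  "is_ito_integral M W T H Y \<longleftrightarrow>
     ito_integrable M W T H \<and> Y \<in> borel_measurable M \<and>
     (\<exists>n t \<xi>. (\<forall>k::nat. elementary_integrand M W T (n k) (t k) (\<xi> k)) \<and>
        (\<lambda>k. \<integral>\<^sup>+\<omega>. (\<integral>\<^sup>+x\<in>{0..T}.
            ennreal ((H x \<omega> - elementary_process (n k) (t k) (\<xi> k) x \<omega>)\<^sup>2) \<partial>lborel) \<partial>M)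
          \<longlonglongrightarrow> 0 \<and>
        (\<lambda>k. \<integral>\<^sup>+\<omega>. ennreal ((Y \<omega> - elementary_integral W (n k) (t k) (\<xi> k) \<omega>)\<^sup>2) \<partial>M)
          \<longlonglongrightarrow> 0)"

(* The second set consists of the vertical segments joining X(t-) to X(t) at the
   discontinuities t of the restriction of X to I. *)
definition process_graph :: "real set \<Rightarrow> (real \<Rightarrow> real) \<Rightarrow> (real \<times> real) set" where
  "process_graph I X =
     {(t, y). t \<in> I \<and> y = X t} \<union>
     {(t, y). t \<in> I \<and> \<not> continuous (at t within I) X \<and>
              y \<in> closed_segment (Lim (at t within (I \<inter> {..<t})) X) (X t)}"

definition grid_square :: "real \<Rightarrow> int \<Rightarrow> int \<Rightarrow> (real \<times> real) set" where
  "grid_square r i j =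
     {of_int i * r..(of_int i + 1) * r} \<times> {of_int j * r..(of_int j + 1) * r}"

definition grid_count :: "(real \<times> real) set \<Rightarrow> real \<Rightarrow> nat" where
  "grid_count E r = card {(i, j). grid_square r i j \<inter> E \<noteq> {}}"

definition homogeneous_set :: "real \<Rightarrow> (real \<times> real) set \<Rightarrow> bool" where
  "homogeneous_set s F \<longleftrightarrow>
     (\<exists>C>0. \<forall>R>0. \<forall>r\<in>{0<..R}. \<forall>x\<in>F. real (grid_count (cball x R \<inter> F) r) \<le> C * (R / r) powr s)"

(* The set is never empty, since every planar set is 2-homogeneous. *)
definition assouad_dim :: "(real \<times> real) set \<Rightarrow> real" where
  "assouad_dim F = Inf {s. 0 \<le> s \<and> homogeneous_set s F}"

end

theory Submission
  imports Defs
begin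

text \<open>
  A graph \<open>{(t, g t)}\<close> has Assouad dimension 2 as soon as for every \<open>N\<close> there is an interval
  \<open>[a, a + R]\<close>, cut into \<open>N\<close> columns, on which \<open>g - g a\<close> passes at each column end
  alternately above \<open>R\<close> and below \<open>-R\<close>: by the intermediate value theorem the graph then meets a
  fixed proportion of the \<open>N\<^sup>2\<close> squares of side \<open>R / N\<close> in the ball of radius \<open>2 R\<close>.

  The increments of \<open>B\<close> are independent centred Gaussians with variances \<open>\<integral> f\<^sup>2\<close>. At a Lebesgue point
  \<open>a\<close> of \<open>f\<^sup>2\<close> with \<open>f a \<noteq> 0\<close> and for small \<open>R\<close>, the increments over the columns have nearly equal
  standard deviations \<open>\<sigma>\<close> of order \<open>sqrt R\<close>, hence much larger than \<open>R\<close>, and the alternation above has a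
  probability bounded below in terms of \<open>N\<close> only. Infinitely many disjoint intervals of this kind fit into
  \<open>[0, 1]\<close>, so one of the independent attempts almost surely succeeds.

  The law of \<open>B\<close> is accessed only through approximation: step integrals over disjoint intervals
  are exactly independent and Gaussian, the failure bound is proved for them, and it is transferred to
  \<open>B\<close> with Chebyshev's inequality.
\<close>

section \<open>Graphs that oscillate across all columns\<close>

text \<open>The difficulty is that \<open>is_ito_integral\<close> fixes each \<open>B t\<close>
  separately, as an L2 limit and up to a null set, so that neither the joint law of the increments
  nor their independence can be read off. For a given number \<open>K\<close> of attempts, however,
  only finitely many times matter. One deterministic step function close to \<open>f\<close> in L2
  serves them all, and its error can be chosen after \<open>K\<close>: all attempts fail with
  probability at most \<open>(1 - p) ^ K\<close> plus an arbitrary \<epsilon>, and only then does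
  \<open>K\<close> grow. This needs slack, which is why the partial sums are driven beyond \<sigma>,
  at least \<open>2 * R\<close>, although \<open>R\<close> would do: the approximation may be wrong
  by \<open>R\<close>. Alternation is forced by growing boxes: increment number \<open>i\<close>,
  multiplied by \<open>(-1) ^ i\<close>, is asked to lie between \<open>3 ^ i * \<sigma>\<close> and
  3/2 times that. Prescribing increments rather than partial sums makes an attempt a product event,
  and as the boxes scale with \<sigma>, its probability is bounded below in terms of
  \<open>N\<close> alone as long as the variances are comparable to the square of \<sigma>.\<close>

lemma grid_index_bounds:
  fixes E :: "(real \<times> real) set"
  assumes "0 < r" and "E \<subseteq> cball x R" and "grid_square r i j \<inter> E \<noteq> {}"
  shows "(i, j) \<in> {\<lceil>(fst x - R) / r\<rceil> - 1..\<lfloor>(fst x + R) / r\<rfloor>} \<times>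
    {\<lceil>(snd x - R) / r\<rceil> - 1..\<lfloor>(snd x + R) / r\<rfloor>}"
proof -
  obtain p where p: "p \<in> grid_square r i j" "p \<in> cball x R" using assms by blast
  have "dist (fst x) (fst p) \<le> R" "dist (snd x) (snd p) \<le> R"
    using p(2) dist_fst_le[of x p] dist_snd_le[of x p] by auto
  then have b: "fst x - R \<le> fst p" "fst p \<le> fst x + R" "snd x - R \<le> snd p" "snd p \<le> snd x + R"
    by (auto simp: dist_real_def)
  have g: "of_int i * r \<le> fst p" "fst p \<le> (of_int i + 1) * r"
    "of_int j * r \<le> snd p" "snd p \<le> (of_int j + 1) * r"
    using p(1) by (auto simp: grid_square_def mem_Times_iff)
  have *: "k \<in> {\<lceil>(c - R) / r\<rceil> - 1..\<lfloor>(c + R) / r\<rfloor>}"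
    if "of_int k * r \<le> y" "y \<le> (of_int k + 1) * r" "c - R \<le> y" "y \<le> c + R" for k :: int and c y :: real
  proof -
    \<comment> \<open>Only the right edge \<open>(k + 1) * r\<close> of the cell needs to reach
      \<open>c - R\<close>; hence the \<open>- 1\<close> in the range.\<close>
    have "(c - R) / r \<le> of_int (k + 1)" "of_int k \<le> (c + R) / r"
      using that assms(1) by (simp_all add: field_simps)
    then show ?thesis by (simp add: le_floor_iff ceiling_le_iff) linarith
  qed
  show ?thesis
    using *[OF g(1,2) b(1,2)] *[OF g(3,4) b(3,4)] by auto
qed

lemma finite_grid_squares_meeting:
  assumes "0 < r" and "E \<subseteq> cball x R"
  shows "finite {(i, j). grid_square r i j \<inter> E \<noteq> {}}"
  by (rule finite_subset[of _ "{\<lceil>(fst x - R) / r\<rceil> - 1..\<lfloor>(fst x + R) / r\<rfloor>} \<times>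
        {\<lceil>(snd x - R) / r\<rceil> - 1..\<lfloor>(snd x + R) / r\<rfloor>}"])
     (auto dest!: grid_index_bounds[OF assms])

text \<open>In each coordinate an interval of length \<open>2 * R\<close> meets at most
  \<open>2 * (R / r) + 2\<close> grid cells, and \<open>1 \<le> R / r\<close> turns this into
  \<open>5 * (R / r)\<close>; hence the constant 25. This bounds every planar Assouad dimension by
  2.\<close>

lemma homogeneous_set_2: "homogeneous_set 2 F"
  unfolding homogeneous_set_def
proof (intro exI[of _ 25] conjI allI impI ballI)
  fix R r :: real and x assume R: "0 < R" and "r \<in> {0<..R}" and x: "x \<in> F"
  then have r: "0 < r" "r \<le> R" by auto
  define I where "I c = {\<lceil>(c - R) / r\<rceil> - 1..\<lfloor>(c + R) / r\<rfloor>}" for c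
  have card_I: "real (card (I c)) \<le> 5 * (R / r)" for c
  proof -
    have "real_of_int \<lfloor>(c + R) / r\<rfloor> - \<lceil>(c - R) / r\<rceil> \<le> (c + R) / r - (c - R) / r"
      by linarith
    also have "\<dots> = 2 * (R / r)" by (simp add: diff_divide_distrib add_divide_distrib)
    finally have "real (card (I c)) \<le> max 0 (2 * (R / r) + 2)" unfolding I_def by simp
    moreover have "1 \<le> R / r" using r by simp
    ultimately show ?thesis by linarith
  qed
  have "grid_count (cball x R \<inter> F) r \<le> card (I (fst x) \<times> I (snd x))"
    unfolding grid_count_def
    by (rule card_mono) (auto simp: I_def dest!: grid_index_bounds[OF r(1), of "cball x R \<inter> F" x R, OF Int_lower1])
  then have "real (grid_count (cball x R \<inter> F) r) \<le> real (card (I (fst x))) * real (card (I (snd x)))"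
    by (simp add: card_cartesian_product flip: of_nat_mult)
  also have "\<dots> \<le> (5 * (R / r)) * (5 * (R / r))"
    using card_I R r by (intro mult_mono) auto
  also have "\<dots> = 25 * (R / r) powr 2"
    using R r by (simp add: powr_numeral power2_eq_square)
  finally show "real (grid_count (cball x R \<inter> F) r) \<le> 25 * (R / r) powr 2" .
qed simp

text \<open>Only the \<open>n\<close> columns from \<open>a + (2 * i + 1) * h\<close> to
  \<open>a + (2 * i + 2) * h\<close> are counted. On each, \<open>g\<close> falls from
  \<open>g a + R\<close> or more to \<open>g a - R\<close> or less and so takes all the
  \<open>2 * n\<close> values \<open>g a + j * h\<close>. Consecutive values lie in consecutive grid
  rows, and the skipped columns keep points of different counted columns at least \<open>h\<close>
  apart, hence in different grid columns.\<close>

lemma grid_count_oscillating_graph: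
  fixes g :: "real \<Rightarrow> real" and n :: nat
  assumes n: "0 < n" and R: "0 < R" and h: "h = R / (2 * real n)"
    and cont: "continuous_on {a..a + R} g"
    and osc: "\<And>i. i < 2 * n \<Longrightarrow> (-1) ^ i * (g (a + (real i + 1) * h) - g a) \<ge> R"
    and graph: "\<And>t. t \<in> {a..a + R} \<Longrightarrow> (t, g t) \<in> F"
  shows "2 * n\<^sup>2 \<le> grid_count (cball (a, g a) (2 * R) \<inter> F) h"
proof -
  have hp: "0 < h" using n R h by simp
  have Rh: "R = 2 * real n * h" using n h by simp
  have ex: "\<exists>x. a + (2 * real i + 1) * h \<le> x \<and> x \<le> a + (2 * real i + 2) * h \<and> g x = g a + real j * h"
    if "i < n" "j < 2 * n" for i j
  proof -
    have "real j * h \<le> R" using that(2) Rh hp by (simp add: mult_right_mono)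
    moreover have "0 \<le> real j * h" using hp by simp
    moreover have "g a + R \<le> g (a + (2 * real i + 1) * h)"
      using osc[of "2 * i"] that by (simp add: power_mult)
    moreover have "g (a + (2 * real i + 2) * h) \<le> g a - R"
      using osc[of "2 * i + 1"] that by (simp add: power_mult) (simp add: algebra_simps)
    moreover have "{a + (2 * real i + 1) * h..a + (2 * real i + 2) * h} \<subseteq> {a..a + R}"
    proof -
      have "(2 * real i + 2) * h \<le> R" unfolding Rh using that(1) hp by (intro mult_right_mono) auto
      moreover have "0 \<le> (2 * real i + 1) * h" using hp by simp
      ultimately show ?thesis by auto
    qed
    moreover have "a + (2 * real i + 1) * h \<le> a + (2 * real i + 2) * h" using hp by simp
    ultimately show ?thesis
      using R by (intro IVT2' continuous_on_subset[OF cont]) linarith+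
  qed
  define X where "X i j = (SOME x. a + (2 * real i + 1) * h \<le> x \<and> x \<le> a + (2 * real i + 2) * h
    \<and> g x = g a + real j * h)" for i j
  have X: "a + (2 * real i + 1) * h \<le> X i j" "X i j \<le> a + (2 * real i + 2) * h"
    "g (X i j) = g a + real j * h" if "i < n" "j < 2 * n" for i j
    using someI_ex[OF ex[OF that]] unfolding X_def by auto
  \<comment> \<open>Indices of a grid square containing the crossing point; the grid is anchored at
    the origin and not at \<open>(a, g a)\<close>, hence the floors.\<close>
  define \<Phi> where "\<Phi> = (\<lambda>(i, j). (\<lfloor>X i j / h\<rfloor>, \<lfloor>(g a + real j * h) / h\<rfloor>))"
  have fl: "\<lfloor>(g a + real j * h) / h\<rfloor> = \<lfloor>g a / h\<rfloor> + int j" for j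
    using hp by (simp add: add_divide_distrib)
  have inj: "inj_on \<Phi> ({..<n} \<times> {..<2 * n})"
  proof (rule inj_onI)
    fix p q assume pq: "p \<in> {..<n} \<times> {..<2 * n}" "q \<in> {..<n} \<times> {..<2 * n}" "\<Phi> p = \<Phi> q"
    obtain i j k l where p: "p = (i, j)" and q: "q = (k, l)" by fastforce
    have jl: "j = l" using pq(3) by (simp add: \<Phi>_def p q fl)
    have f: "\<lfloor>X i j / h\<rfloor> = \<lfloor>X k l / h\<rfloor>" using pq(3) by (simp add: \<Phi>_def p q)
    have B: "a / h + (2 * real i + 1) \<le> X i j / h \<and> X i j / h \<le> a / h + (2 * real i + 2)"
      if "i < n" "j < 2 * n" for i j
      using divide_right_mono[OF X(1)[OF that], of h] divide_right_mono[OF X(2)[OF that], of h] hp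
      by (simp add: add_divide_distrib)
    have False if "i + 1 \<le> k" "i < n" "k < n" "j < 2 * n" "l < 2 * n" "\<lfloor>X i j / h\<rfloor> = \<lfloor>X k l / h\<rfloor>"
      for i j k l
    proof -
      have "X i j / h + 1 \<le> X k l / h" using B[of i j] B[of k l] that by linarith
      then show False using that(6) by linarith
    qed
    from this[of i k j l] this[of k i l j] have "i = k"
      using pq f p q by (metis SigmaD1 SigmaD2 Suc_eq_plus1 Suc_leI lessThan_iff linorder_neqE_nat)
    then show "p = q" using jl p q by simp
  qed
  have sub: "\<Phi> ` ({..<n} \<times> {..<2 * n}) \<subseteq> {(i, j). grid_square h i j \<inter> (cball (a, g a) (2 * R) \<inter> F) \<noteq> {}}"
  proof clarify
    fix u v i j assume uv: "(u, v) = \<Phi> (i, j)" and ij: "i < n" "j < 2 * n"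
    define x where "x = X i j"
    note Xx = X[OF ij, folded x_def]
    have jR: "real j * h \<le> R" using ij(2) Rh hp by (simp add: mult_right_mono)
    have "(2 * real i + 2) * h \<le> R" unfolding Rh using ij(1) hp by (intro mult_right_mono) auto
    moreover have "0 \<le> (2 * real i + 1) * h" using hp by simp
    ultimately have xR: "a \<le> x" "x \<le> a + R" using Xx by linarith+
    have "dist (a, g a) (x, g x) \<le> \<bar>a - x\<bar> + \<bar>g a - g x\<bar>"
      unfolding dist_Pair_Pair dist_real_def by (rule order_trans[OF sqrt_sum_squares_le_sum_abs]) simp
    also have "\<dots> \<le> 2 * R" using xR Xx jR hp by simp
    finally have "(x, g x) \<in> cball (a, g a) (2 * R)" by simp
    moreover have "(x, g x) \<in> F" using graph xR by auto
    moreover have fl2: "\<lfloor>y / h\<rfloor> * h \<le> y \<and> y \<le> (\<lfloor>y / h\<rfloor> + 1) * h" for y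
    proof -
      have "\<lfloor>y / h\<rfloor> * h \<le> y / h * h" "y / h * h \<le> (\<lfloor>y / h\<rfloor> + 1) * h"
        using hp by (intro mult_right_mono; linarith)+
      then show ?thesis using hp by simp
    qed
    have "(x, g x) \<in> grid_square h u v"
      using uv fl2[of x] fl2[of "g x"] Xx by (simp add: \<Phi>_def grid_square_def x_def)
    ultimately show "grid_square h u v \<inter> (cball (a, g a) (2 * R) \<inter> F) = {} \<Longrightarrow> False" by blast
  qed
  have "card ({..<n} \<times> {..<2 * n}) \<le> grid_count (cball (a, g a) (2 * R) \<inter> F) h"
    unfolding grid_count_def card_image[OF inj, symmetric]
    by (rule card_mono[OF finite_grid_squares_meeting[OF hp] sub]) auto
  then show ?thesis by (simp add: card_cartesian_product power2_eq_square)
qed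

text \<open>The quotient of the ball radius \<open>2 * R\<close> and the side
  \<open>R / (2 * n)\<close> is \<open>4 * n\<close> whatever \<open>R\<close> is. Homogeneity with
  exponent \<open>s\<close> thus gives \<open>2 * n\<^sup>2 \<le> C * (4 * n) powr s\<close> for all
  \<open>n\<close>, which fails for large \<open>n\<close> when \<open>s < 2\<close>.\<close>

lemma assouad_dim_oscillating_graph:
  fixes g :: "real \<Rightarrow> real"
  assumes cont: "continuous_on {0..1} g"
    and osc: "\<And>n. 0 < n \<Longrightarrow> \<exists>a R. 0 < R \<and> 0 \<le> a \<and> a + R \<le> 1 \<and>
        (\<forall>i < 2 * n. (-1) ^ i * (g (a + (real i + 1) * (R / (2 * real n))) - g a) \<ge> R)"
  shows "assouad_dim (process_graph {0..1} g) = 2"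
  unfolding assouad_dim_def
proof (rule cInf_eq_minimum)
  define F where "F = process_graph {0..1} g"
  show "2 \<in> {s. 0 \<le> s \<and> homogeneous_set s (process_graph {0..1} g)}"
    using homogeneous_set_2 by simp
  fix s assume "s \<in> {s. 0 \<le> s \<and> homogeneous_set s (process_graph {0..1} g)}"
  then obtain C where s: "0 \<le> s" and C: "0 < C"
    "\<And>R r x. 0 < R \<Longrightarrow> r \<in> {0<..R} \<Longrightarrow> x \<in> F \<Longrightarrow> real (grid_count (cball x R \<inter> F) r) \<le> C * (R / r) powr s"
    unfolding homogeneous_set_def F_def by blast
  show "2 \<le> s"
  proof (rule ccontr)
    assume "\<not> 2 \<le> s"
    have bound: "real n powr (2 - s) \<le> C * 4 powr s / 2" if n: "0 < n" for n
    proof -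
      obtain a R where aR: "0 < R" "0 \<le> a" "a + R \<le> 1"
        "\<And>i. i < 2 * n \<Longrightarrow> (-1) ^ i * (g (a + (real i + 1) * (R / (2 * real n))) - g a) \<ge> R"
        using osc[OF n] by blast
      define h where "h = R / (2 * real n)"
      have graph: "(t, g t) \<in> F" if "t \<in> {a..a + R}" for t
        using that aR by (auto simp: F_def process_graph_def)
      have "2 * n\<^sup>2 \<le> grid_count (cball (a, g a) (2 * R) \<inter> F) h"
        using aR n graph
        by (intro grid_count_oscillating_graph[OF n aR(1) h_def])
           (auto simp: h_def intro: continuous_on_subset[OF cont])
      then have "2 * real n ^ 2 \<le> real (grid_count (cball (a, g a) (2 * R) \<inter> F) h)"
        by (metis of_nat_le_iff of_nat_mult of_nat_numeral of_nat_power)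
      also have "\<dots> \<le> C * (2 * R / h) powr s"
      proof (rule C(2))
        have "R \<le> real n * 4 * R" using n aR(1) by (simp add: mult_le_cancel_right1)
        then show "h \<in> {0<..2 * R}" using n aR(1) by (auto simp: h_def field_simps)
      qed (use aR graph in auto)
      also have "2 * R / h = 4 * real n" using n aR(1) by (simp add: h_def)
      finally have "2 * real n ^ 2 \<le> C * 4 powr s * real n powr s"
        using n by (simp add: powr_mult mult.assoc)
      moreover have "real n ^ 2 = real n powr (2 - s) * real n powr s"
        using n by (simp add: powr_add[symmetric] powr_numeral)
      ultimately have "2 * real n powr (2 - s) * real n powr s \<le> C * 4 powr s * real n powr s"
        by (simp add: mult.assoc)
      then show ?thesis using n by simp
    qed
    define D where "D = C * 4 powr s / 2"
    obtain n where n: "D powr (1 / (2 - s)) < real n" using reals_Archimedean2 by blast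
    then have n0: "0 < n" using le_less_trans[OF powr_ge_zero n] by simp
    have "D = (D powr (1 / (2 - s))) powr (2 - s)"
      using C(1) \<open>\<not> 2 \<le> s\<close> by (simp add: powr_powr D_def)
    also have "\<dots> < real n powr (2 - s)"
      using n \<open>\<not> 2 \<le> s\<close> by (intro powr_less_mono2) auto
    finally show False using bound[OF n0] by (simp add: D_def)
  qed
qed

section \<open>Lebesgue points and independent attempts\<close>

text \<open>A Lebesgue point controls only the integrals over intervals that start at
  \<open>a\<close>. A column is a difference of two of these, and its error is proportional to the
  length of up to \<open>N\<close> columns; the tolerance \<open>e\<close> therefore carries a
  factor \<open>1 / N\<close>.\<close>

lemma lebesgue_point_columns:
  fixes q :: "real \<Rightarrow> real" and N :: nat
  assumes q: "integrable lborel q" "\<And>x. 0 \<le> q x"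
    and zero: "finite {x \<in> {u<..<v}. q x = 0}" and uv: "u < v" and N: "0 < N"
  shows "\<exists>a R \<sigma>. u < a \<and> a + R < v \<and> 0 < R \<and> 0 < \<sigma> \<and> 2 * R \<le> \<sigma> \<and>
    (\<forall>i<N. 3 / 4 * \<sigma>\<^sup>2 \<le> (\<integral>x. q x * indicator {a + real i * (R / N)..<a + (real i + 1) * (R / N)} x \<partial>lborel) \<and>
           (\<integral>x. q x * indicator {a + real i * (R / N)..<a + (real i + 1) * (R / N)} x \<partial>lborel) \<le> 5 / 4 * \<sigma>\<^sup>2)"
proof -
  have setint: "set_integrable lborel S q" if "S \<in> sets borel" for S
    unfolding set_integrable_def real_scaleR_def
    using integrable_real_mult_indicator[OF _ q(1), of S] that by (simp add: mult.commute)
  have "q integrable_on cbox c d" for c d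
    using set_borel_integral_eq_integral(1)[OF setint, of "cbox c d"] by simp
  then obtain Z where Z: "negligible Z"
    "\<And>x e. x \<notin> Z \<Longrightarrow> 0 < e \<Longrightarrow>
       \<exists>d>0. \<forall>h. 0 < h \<and> h < d \<longrightarrow> norm (integral (cbox x (x + h *\<^sub>R One)) q /\<^sub>R h ^ DIM(real) - q x) < e"
    by (rule integrable_ccontinuous_explicit[of q]) blast
  have "\<not> negligible {u<..<v}"
    using uv by (simp add: open_not_negligible)
  moreover have "negligible (Z \<union> {x \<in> {u<..<v}. q x = 0})"
    using Z(1) zero by (simp add: negligible_finite)
  ultimately have "\<not> {u<..<v} \<subseteq> Z \<union> {x \<in> {u<..<v}. q x = 0}"
    using negligible_subset by blast
  then obtain a where a: "u < a" "a < v" "a \<notin> Z" "q a \<noteq> 0" by force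
  define c where "c = q a"
  have c: "0 < c" using q(2)[of a] a(4) by (simp add: c_def)
  \<comment> \<open>With 8 in the denominator the errors at both ends of a column add up to less
    than \<open>2 * N * e * h\<close>, which is a quarter of
    \<open>\<sigma>\<^sup>2 = c * h\<close>.\<close>
  define e where "e = c / (8 * real N)"
  have e: "0 < e" using c N by (simp add: e_def)
  obtain d where d: "0 < d"
    "\<And>h. 0 < h \<Longrightarrow> h < d \<Longrightarrow> norm (integral (cbox a (a + h *\<^sub>R One)) q /\<^sub>R h ^ DIM(real) - q a) < e"
    using Z(2)[OF a(3) e] by auto
  define G where "G h = (\<integral>x. q x * indicator {a..<a + h} x \<partial>lborel)" for h
  have G: "\<bar>G h - c * h\<bar> \<le> e * h" if "0 \<le> h" "h < d" for h
  proof (cases "h = 0")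
    case True then show ?thesis by (simp add: G_def)
  next
    case False
    then have h: "0 < h" using that by simp
    have "G h = (LINT x:{a..a + h}|lborel. q x)"
      unfolding G_def set_lebesgue_integral_def
    proof (rule integral_cong_AE)
      show "AE x in lborel. q x * indicator {a..<a + h} x = indicator {a..a + h} x *\<^sub>R q x"
        using AE_lborel_singleton[of "a + h"] by eventually_elim (auto simp: indicator_def)
    qed (use q(1) in auto)
    also have "\<dots> = integral {a..a + h} q"
      by (rule set_borel_integral_eq_integral(2)[OF setint]) simp
    finally have "\<bar>G h / h - c\<bar> < e"
      using d(2)[OF h that(2)] by (simp add: c_def divide_inverse mult.commute)
    then have "\<bar>G h / h - c\<bar> * h \<le> e * h" using h by simp
    moreover have "G h - c * h = (G h / h - c) * h" using h by (simp add: left_diff_distrib)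
    ultimately show ?thesis using h by (simp add: abs_mult)
  qed
  \<comment> \<open>The first two bounds keep the interval within reach of the Lebesgue estimate and
    inside \<open>{u<..<v}\<close>; the third gives
    \<open>4 * R\<^sup>2 \<le> c * R / N = \<sigma>\<^sup>2\<close>, that is
    \<open>2 * R \<le> \<sigma>\<close>.\<close>
  define R where "R = min (d / 2) (min ((v - a) / 2) (c / (4 * real N)))"
  have R: "0 < R" "R < d" "a + R < v" "R \<le> c / (4 * real N)"
  proof -
    have "R \<le> d / 2" "R \<le> (v - a) / 2" "R \<le> c / (4 * real N)"
      unfolding R_def by linarith+
    then show "R < d" "a + R < v" "R \<le> c / (4 * real N)"
      using d(1) a(2) by (simp_all add: field_simps)
    show "0 < R" using d(1) a(2) c N by (simp add: R_def)
  qed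
  define h where "h = R / real N"
  have h: "0 < h" "real N * h = R" using R N by (auto simp: h_def)
  define \<sigma> where "\<sigma> = sqrt (c * h)"
  have \<sigma>: "0 < \<sigma>" "\<sigma>\<^sup>2 = c * h" using c h by (auto simp: \<sigma>_def)
  have "2 * R \<le> \<sigma>"
    unfolding \<sigma>_def
  proof (rule real_le_rsqrt)
    have "(2 * R)\<^sup>2 = 4 * R * R" by (simp add: power2_eq_square)
    also have "\<dots> \<le> 4 * R * (c / (4 * real N))" using R by (intro mult_left_mono) auto
    also have "\<dots> = c * h" using N by (simp add: h_def)
    finally show "(2 * R)\<^sup>2 \<le> c * h" .
  qed
  moreover have "3 / 4 * \<sigma>\<^sup>2 \<le> (\<integral>x. q x * indicator {a + real i * h..<a + (real i + 1) * h} x \<partial>lborel) \<and>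
           (\<integral>x. q x * indicator {a + real i * h..<a + (real i + 1) * h} x \<partial>lborel) \<le> 5 / 4 * \<sigma>\<^sup>2" if i: "i < N" for i
  proof -
    define z where "z = real i * h"
    have z: "0 \<le> z" "(real i + 1) * h = z + h" using h by (auto simp: z_def algebra_simps)
    have "(\<integral>x. q x * indicator {a + real i * h..<a + (real i + 1) * h} x \<partial>lborel) =
      (\<integral>x. q x * indicator {a..<a + (real i + 1) * h} x - q x * indicator {a..<a + real i * h} x \<partial>lborel)"
      unfolding z(2) z_def[symmetric] using z(1) h(1)
      by (intro Bochner_Integration.integral_cong) (auto simp: indicator_def)
    also have "\<dots> = G ((real i + 1) * h) - G (real i * h)"
      unfolding G_def using q(1) by (intro Bochner_Integration.integral_diff integrable_real_mult_indicator) auto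
    finally have eq: "(\<integral>x. q x * indicator {a + real i * h..<a + (real i + 1) * h} x \<partial>lborel) =
      G ((real i + 1) * h) - G (real i * h)" .
    have le: "(real i + 1) * h \<le> R" using i h by (subst h(2)[symmetric], intro mult_right_mono) auto
    have le2: "real i * h \<le> (real i + 1) * h" "0 \<le> real i * h" using h by auto
    have "\<bar>G ((real i + 1) * h) - c * ((real i + 1) * h)\<bar> \<le> e * ((real i + 1) * h)"
      using le le2 R(2) by (intro G) linarith+
    moreover have "\<bar>G (real i * h) - c * (real i * h)\<bar> \<le> e * (real i * h)"
      using le le2 R(2) by (intro G) linarith+
    moreover have "c * ((real i + 1) * h) - c * (real i * h) = \<sigma>\<^sup>2" using \<sigma> by (simp add: algebra_simps)
    moreover have "e * ((real i + 1) * h) + e * (real i * h) < \<sigma>\<^sup>2 / 4"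
    proof -
      have "e * ((real i + 1) * h) + e * (real i * h) = e * ((2 * real i + 1) * h)" by (simp add: algebra_simps)
      also have "\<dots> < e * ((2 * real N) * h)" using i e h by (intro mult_strict_left_mono mult_strict_right_mono) auto
      also have "\<dots> = \<sigma>\<^sup>2 / 4" using N by (simp add: e_def \<sigma>)
      finally show ?thesis .
    qed
    ultimately show ?thesis unfolding eq by (simp only: abs_le_iff) linarith
  qed
  ultimately show ?thesis using a R \<sigma>(1) unfolding h_def by blast
qed

text \<open>Each term dominates the sum of its predecessors, so the partial sums alternate in sign.\<close>

lemma alternating_partial_sums:
  fixes D :: "nat \<Rightarrow> real"
  assumes "0 \<le> \<sigma>" and D: "\<And>i. i < N \<Longrightarrow> 3 ^ i * \<sigma> \<le> (-1) ^ i * D i \<and> (-1) ^ i * D i \<le> 3 / 2 * (3 ^ i * \<sigma>)"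
    and "i < N"
  shows "\<sigma> \<le> (-1) ^ i * (\<Sum>k<Suc i. D k)"
proof -
  have D': "\<bar>D i\<bar> \<le> 3 / 2 * (3 ^ i * \<sigma>)" if "i < N" for i
  proof -
    have "0 \<le> 3 ^ i * \<sigma>" using assms(1) by simp
    then have "\<bar>(-1) ^ i * D i\<bar> \<le> 3 / 2 * (3 ^ i * \<sigma>)" using D[OF that] by linarith
    then show ?thesis by (simp add: abs_mult)
  qed
  \<comment> \<open>A geometric sum with ratio 3. Subtracting it from
    \<open>3 ^ i * \<sigma>\<close> leaves the factor \<open>3 ^ i / 4 + 3 / 4\<close> of \<sigma>,
    which is at least 1.\<close>
  have S: "\<bar>\<Sum>k<i. D k\<bar> \<le> 3 / 4 * (3 ^ i - 1) * \<sigma>" if "i \<le> N" for i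
    using that
  proof (induction i)
    case (Suc i)
    have "\<bar>\<Sum>k<Suc i. D k\<bar> \<le> \<bar>\<Sum>k<i. D k\<bar> + \<bar>D i\<bar>" by simp
    also have "\<dots> \<le> 3 / 4 * (3 ^ i - 1) * \<sigma> + 3 / 2 * (3 ^ i * \<sigma>)"
      using Suc D'[of i] by (intro add_mono) auto
    also have "\<dots> = 3 / 4 * (3 ^ Suc i - 1) * \<sigma>" by (simp add: field_simps)
    finally show ?case .
  qed simp
  have "\<bar>(-1) ^ i * (\<Sum>k<i. D k)\<bar> \<le> 3 / 4 * (3 ^ i - 1) * \<sigma>" using S[of i] assms by (simp add: abs_mult)
  moreover have "(-1) ^ i * (\<Sum>k<Suc i. D k) = (-1) ^ i * (\<Sum>k<i. D k) + (-1) ^ i * D i"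
    by (simp add: algebra_simps)
  moreover have "\<sigma> \<le> 3 ^ i * \<sigma>" using assms(1) by (simp add: mult_le_cancel_right1)
  moreover have "3 / 4 * (3 ^ i - 1) * \<sigma> = 3 / 4 * (3 ^ i * \<sigma>) - 3 / 4 * \<sigma>"
    by (simp only: right_diff_distrib left_diff_distrib mult.assoc)
  ultimately show ?thesis using D[OF assms(3)] by linarith
qed

text \<open>The length \<open>x * \<sigma> / 2\<close> of the interval times a lower bound for the
  density on it. The lower bound on \<open>s\<close> enters the exponent, the upper bound the
  normalising factor; \<sigma> cancels, so the estimate is the same at every scale.\<close>

lemma (in prob_space) normal_interval_lower_bound:
  assumes X: "distributed M lborel X (normal_density 0 s)" and s: "0 < s"
    and \<sigma>: "0 < \<sigma>" "\<sigma>\<^sup>2 / 2 \<le> s\<^sup>2" "s\<^sup>2 \<le> 2 * \<sigma>\<^sup>2" and x: "0 < x"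
  shows "x / (4 * sqrt pi) * exp (- 9 / 4 * x\<^sup>2) \<le> prob {\<omega> \<in> space M. x * \<sigma> \<le> X \<omega> \<and> X \<omega> \<le> 3 / 2 * (x * \<sigma>)}"
proof -
  define A where "A = {x * \<sigma>..3 / 2 * (x * \<sigma>)}"
  define c where "c = exp (- 9 / 4 * x\<^sup>2) / (2 * \<sigma> * sqrt pi)"
  have dens: "c \<le> normal_density 0 s y" if "y \<in> A" for y
  proof -
    have "0 < x * \<sigma>" using x \<sigma> by simp
    then have "y\<^sup>2 \<le> (3 / 2 * (x * \<sigma>))\<^sup>2" using that by (intro power_mono) (auto simp: A_def)
    also have "\<dots> = 9 / 4 * x\<^sup>2 * \<sigma>\<^sup>2" by (simp add: power_mult_distrib power_divide)
    also have "\<dots> \<le> 9 / 4 * x\<^sup>2 * (2 * s\<^sup>2)" using \<sigma> by (intro mult_left_mono) auto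
    finally have "y\<^sup>2 / (2 * s\<^sup>2) \<le> 9 / 4 * x\<^sup>2" using s by (simp add: field_simps)
    then have 1: "exp (- 9 / 4 * x\<^sup>2) \<le> exp (- (y\<^sup>2 / (2 * s\<^sup>2)))" by simp
    have "sqrt (2 * pi * s\<^sup>2) \<le> sqrt (2 * pi * (2 * \<sigma>\<^sup>2))" using \<sigma> by simp
    also have "\<dots> = 2 * \<sigma> * sqrt pi"
      using \<sigma> by (simp add: real_sqrt_mult)
    finally have 2: "sqrt (2 * pi * s\<^sup>2) \<le> 2 * \<sigma> * sqrt pi" .
    have "exp (- 9 / 4 * x\<^sup>2) / (2 * \<sigma> * sqrt pi) \<le> exp (- (y\<^sup>2 / (2 * s\<^sup>2))) / sqrt (2 * pi * s\<^sup>2)"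
      using 1 2 s by (intro frac_le) auto
    then show ?thesis by (simp add: c_def normal_density_def)
  qed
  have c0: "0 \<le> c" using \<sigma> by (simp add: c_def)
  have "ennreal (x / (4 * sqrt pi) * exp (- 9 / 4 * x\<^sup>2)) = ennreal c * ennreal (x * \<sigma> / 2)"
    using c0 \<sigma> x by (simp add: c_def ennreal_mult[symmetric])
  also have "\<dots> = ennreal c * emeasure lborel A"
    using x \<sigma> by (simp add: A_def mult.commute)
  also have "\<dots> = (\<integral>\<^sup>+y. ennreal c * indicator A y \<partial>lborel)"
    by (simp add: nn_integral_cmult_indicator A_def)
  also have "\<dots> \<le> (\<integral>\<^sup>+y. ennreal (normal_density 0 s y) * indicator A y \<partial>lborel)"
    using dens by (intro nn_integral_mono) (auto simp: indicator_def intro: ennreal_leI)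
  also have "\<dots> = emeasure M (X -` A \<inter> space M)"
    by (rule distributed_emeasure[OF X, symmetric]) (simp add: A_def)
  also have "X -` A \<inter> space M = {\<omega> \<in> space M. x * \<sigma> \<le> X \<omega> \<and> X \<omega> \<le> 3 / 2 * (x * \<sigma>)}"
    by (auto simp: A_def)
  finally show ?thesis by (simp add: emeasure_eq_measure)
qed

text \<open>Grouping the array by its first index yields independent attempts, and within an attempt
  all columns hit with probability at least the product of the \<open>p i\<close>. As
  \<open>p\<close> is the same for every attempt, the bound is a power.\<close>

lemma (in prob_space) indep_attempts_all_fail:
  fixes X :: "nat \<times> nat \<Rightarrow> 'a \<Rightarrow> real" and p :: "nat \<Rightarrow> real"
  assumes ind: "indep_vars (\<lambda>_. borel) X ({..<K} \<times> {..<N})" and N: "0 < N"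
    and A: "\<And>l i. A l i \<in> sets borel"
    and p: "\<And>i. 0 \<le> p i"
      "\<And>l i. l < K \<Longrightarrow> i < N \<Longrightarrow> p i \<le> prob {\<omega> \<in> space M. X (l, i) \<omega> \<in> A l i}"
  shows "prob {\<omega> \<in> space M. \<forall>l<K. \<exists>i<N. X (l, i) \<omega> \<notin> A l i} \<le> (1 - (\<Prod>i<N. p i)) ^ K"
proof (cases "K = 0")
  \<comment> \<open>For \<open>K = 0\<close> the intersection of the failure events would be
    \<open>UNIV\<close> instead of \<open>space M\<close>.\<close>
  case False
  have rv[measurable]: "X (l, i) \<in> borel_measurable M" if "l < K" "i < N" for l i
    using ind that by (auto simp: indep_vars_def)
  have [measurable]: "\<And>l i. A l i \<in> sets borel" by (rule A)
  define E where "E l = {\<omega> \<in> space M. \<exists>i<N. X (l, i) \<omega> \<notin> A l i}" for l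
  have "indep_vars (\<lambda>l. PiM ({l} \<times> {..<N}) (\<lambda>_. borel)) (\<lambda>l \<omega>. restrict (\<lambda>j. X j \<omega>) ({l} \<times> {..<N})) {..<K}"
    by (rule indep_vars_restrict[OF ind]) (auto simp: disjoint_family_on_def)
  then have "indep_events (\<lambda>l. {\<omega> \<in> space M. \<exists>i<N. restrict (\<lambda>j. X j \<omega>) ({l} \<times> {..<N}) (l, i) \<notin> A l i}) {..<K}"
  proof (rule indep_eventsI_indep_vars)
    fix l assume "l \<in> {..<K}"
    have "{x \<in> space (PiM ({l} \<times> {..<N}) (\<lambda>_. borel)). \<exists>i<N. x (l, i) \<notin> A l i} =
      (\<Union>i<N. {x \<in> space (PiM ({l} \<times> {..<N}) (\<lambda>_. borel)). x (l, i) \<notin> A l i})" by auto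
    also have "\<dots> \<in> sets (PiM ({l} \<times> {..<N}) (\<lambda>_. borel :: real measure))"
      by (intro sets.finite_UN) auto
    finally show "{x \<in> space (PiM ({l} \<times> {..<N}) (\<lambda>_. borel :: real measure)). \<exists>i<N. x (l, i) \<notin> A l i} \<in>
      sets (PiM ({l} \<times> {..<N}) (\<lambda>_. borel))" .
  qed
  moreover have "{\<omega> \<in> space M. \<exists>i<N. restrict (\<lambda>j. X j \<omega>) ({l} \<times> {..<N}) (l, i) \<notin> A l i} = E l" for l
    by (auto simp: E_def)
  ultimately have "indep_events E {..<K}" by simp
  then have "prob (\<Inter>l<K. E l) = (\<Prod>l<K. prob (E l))"
    using False by (auto simp: indep_events_def lessThan_empty_iff)
  moreover have "prob (E l) \<le> 1 - (\<Prod>i<N. p i)" if "l < K" for l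
  proof -
    have "(\<Prod>i<N. p i) \<le> (\<Prod>i<N. prob (X (l, i) -` A l i \<inter> space M))"
      using p(1) p(2)[OF that] by (intro prod_mono) (auto simp: vimage_def Int_def conj_commute)
    also have "\<dots> = prob (\<Inter>i<N. X (l, i) -` A l i \<inter> space M)"
      using indep_varsD[OF ind, of "Pair l ` {..<N}" "\<lambda>(l, i). A l i"] that N
      by (simp add: prod.reindex inj_on_def lessThan_empty_iff image_subset_iff split_beta)
    also have "(\<Inter>i<N. X (l, i) -` A l i \<inter> space M) = space M - E l"
      using N by (auto simp: E_def)
    also have "prob (space M - E l) = 1 - prob (E l)"
      using that by (intro prob_compl) (auto simp: E_def)
    finally show ?thesis by simp
  qed
  then have "(\<Prod>l<K. prob (E l)) \<le> (\<Prod>l<K. 1 - (\<Prod>i<N. p i))"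
    by (intro prod_mono) auto
  ultimately have "prob (\<Inter>l<K. E l) \<le> (\<Prod>l<K. 1 - (\<Prod>i<N. p i))" by simp
  also have "(\<Inter>l<K. E l) = {\<omega> \<in> space M. \<forall>l<K. \<exists>i<N. X (l, i) \<omega> \<notin> A l i}"
    using False by (auto simp: E_def)
  finally show ?thesis by simp
qed simp

section \<open>The Wiener integral of step functions\<close>

lemma finite_set_increasing_enumeration:
  fixes P :: "real set"
  assumes "finite P" and "P \<noteq> {}"
  obtains n q where "q ` {..n} = P" and "\<And>i. i < n \<Longrightarrow> q i < q (Suc i)"
proof -
  define xs where "xs = sorted_list_of_set P"
  have xs: "set xs = P" "sorted_wrt (<) xs" "xs \<noteq> []" using assms by (auto simp: xs_def)
  show ?thesis
  proof (rule that[of "(!) xs" "length xs - 1"])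
    have "{..length xs - 1} = {..<length xs}" using xs(3) by (cases xs) auto
    then show "(!) xs ` {..length xs - 1} = P" using xs(1) by (simp add: set_conv_nth image_def) auto
    show "xs ! i < xs ! Suc i" if "i < length xs - 1" for i
      using that xs(2) by (simp add: sorted_wrt_nth_less)
  qed
qed

lemma increasing_steps_less:
  fixes q :: "nat \<Rightarrow> real"
  assumes "\<And>i. i < n \<Longrightarrow> q i < q (Suc i)" and "i < j" and "j \<le> n"
  shows "q i < q j"
  using assms(2,3)
proof (induction j)
  case (Suc j)
  then show ?case using assms(1)[of j] by (cases "i = j") auto
qed simp

lemma increasing_steps_le:
  fixes q :: "nat \<Rightarrow> real"
  assumes "\<And>i. i < n \<Longrightarrow> q i < q (Suc i)" and "i \<le> j" and "j \<le> n"
  shows "q i \<le> q j"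
  using increasing_steps_less[of n q i j] assms by (cases "i = j") auto

lemma nn_integral_square_add_le:
  fixes u v :: "'b \<Rightarrow> real"
  assumes [measurable]: "u \<in> borel_measurable N" "v \<in> borel_measurable N"
  shows "(\<integral>\<^sup>+x. ennreal ((u x + v x)\<^sup>2) \<partial>N) \<le>
    2 * (\<integral>\<^sup>+x. ennreal ((u x)\<^sup>2) \<partial>N) + 2 * (\<integral>\<^sup>+x. ennreal ((v x)\<^sup>2) \<partial>N)"
proof -
  have "(\<integral>\<^sup>+x. ennreal ((u x + v x)\<^sup>2) \<partial>N) \<le> (\<integral>\<^sup>+x. 2 * ennreal ((u x)\<^sup>2) + 2 * ennreal ((v x)\<^sup>2) \<partial>N)"
  proof (rule nn_integral_mono)
    fix x
    have "(u x + v x)\<^sup>2 \<le> 2 * (u x)\<^sup>2 + 2 * (v x)\<^sup>2"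
      using zero_le_power2[of "u x - v x"] by (simp add: power2_sum power2_diff)
    then have "ennreal ((u x + v x)\<^sup>2) \<le> ennreal (2 * (u x)\<^sup>2 + 2 * (v x)\<^sup>2)" by (rule ennreal_leI)
    then show "ennreal ((u x + v x)\<^sup>2) \<le> 2 * ennreal ((u x)\<^sup>2) + 2 * ennreal ((v x)\<^sup>2)"
      by (simp add: ennreal_mult)
  qed
  also have "\<dots> = 2 * (\<integral>\<^sup>+x. ennreal ((u x)\<^sup>2) \<partial>N) + 2 * (\<integral>\<^sup>+x. ennreal ((v x)\<^sup>2) \<partial>N)"
    by (subst nn_integral_add) (auto simp: nn_integral_cmult)
  finally show ?thesis .
qed

lemma integrable_mult_of_squares:
  fixes u v :: "'b \<Rightarrow> real"
  assumes [measurable]: "u \<in> borel_measurable N" "v \<in> borel_measurable N"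
    and "integrable N (\<lambda>x. (u x)\<^sup>2)" "integrable N (\<lambda>x. (v x)\<^sup>2)"
  shows "integrable N (\<lambda>x. u x * v x)"
proof (rule Bochner_Integration.integrable_bound)
  show "integrable N (\<lambda>x. (u x)\<^sup>2 + (v x)\<^sup>2)" using assms by simp
  show "AE x in N. norm (u x * v x) \<le> norm ((u x)\<^sup>2 + (v x)\<^sup>2)"
  proof (rule AE_I2)
    fix x
    have "2 * (\<bar>u x\<bar> * \<bar>v x\<bar>) \<le> (u x)\<^sup>2 + (v x)\<^sup>2"
      using zero_le_power2[of "\<bar>u x\<bar> - \<bar>v x\<bar>"] by (simp add: power2_diff)
    moreover have "0 \<le> \<bar>u x\<bar> * \<bar>v x\<bar>" by simp
    ultimately have "\<bar>u x\<bar> * \<bar>v x\<bar> \<le> (u x)\<^sup>2 + (v x)\<^sup>2" by linarith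
    then show "norm (u x * v x) \<le> norm ((u x)\<^sup>2 + (v x)\<^sup>2)" by (simp add: abs_mult)
  qed
qed simp

lemma (in prob_space) normal_second_moment:
  assumes D: "distributed M lborel X (normal_density 0 \<sigma>)" and "0 < \<sigma>"
  shows "expectation (\<lambda>\<omega>. (X \<omega>)\<^sup>2) = \<sigma>\<^sup>2"
  using integral_normal_moment_even[OF assms(2), of 0 1] distributed_integral[OF D, of "\<lambda>x. x\<^sup>2"]
  by (simp add: fact_numeral)

text \<open>The bias-variance decomposition, applied below at each time with \<open>a\<close> the
  value of the integrand and \<open>Z\<close> a coefficient of the elementary process: the mean
  approximates \<open>a\<close> better than \<open>Z\<close> does, and the gain is exactly the
  variance.\<close>

lemma (in prob_space) bounded_variance_decomposition:
  assumes [measurable]: "Z \<in> borel_measurable M" and bdd: "\<And>\<omega>. \<omega> \<in> space M \<Longrightarrow> \<bar>Z \<omega>\<bar> \<le> c"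
  shows "(\<integral>\<^sup>+\<omega>. ennreal ((a - Z \<omega>)\<^sup>2) \<partial>M) =
    ennreal ((a - expectation Z)\<^sup>2 + expectation (\<lambda>\<omega>. (Z \<omega> - expectation Z)\<^sup>2))"
proof -
  define m where "m = expectation Z"
  have Z: "integrable M Z" using bdd by (intro integrable_const_bound[of _ c]) auto
  have Z2: "integrable M (\<lambda>\<omega>. (Z \<omega>)\<^sup>2)"
  proof (intro integrable_const_bound[of _ "c\<^sup>2"] AE_I2)
    fix \<omega> assume "\<omega> \<in> space M"
    then have "\<bar>Z \<omega>\<bar>\<^sup>2 \<le> c\<^sup>2" using bdd by (intro power_mono) auto
    then show "norm ((Z \<omega>)\<^sup>2) \<le> c\<^sup>2" by simp
  qed simp
  have i2: "integrable M (\<lambda>\<omega>. (Z \<omega> - m)\<^sup>2)" using Z Z2 by (simp add: power2_diff)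
  have eq: "(a - Z \<omega>)\<^sup>2 = (a - m)\<^sup>2 + (Z \<omega> - m)\<^sup>2 - 2 * (a - m) * (Z \<omega> - m)" for \<omega>
    by (simp add: power2_eq_square algebra_simps)
  have i1: "integrable M (\<lambda>\<omega>. (a - Z \<omega>)\<^sup>2)" unfolding eq using Z i2 by simp
  have "(\<integral>\<^sup>+\<omega>. ennreal ((a - Z \<omega>)\<^sup>2) \<partial>M) = ennreal (expectation (\<lambda>\<omega>. (a - Z \<omega>)\<^sup>2))"
    using i1 by (intro nn_integral_eq_integral) auto
  also have "expectation (\<lambda>\<omega>. (a - Z \<omega>)\<^sup>2) = (a - m)\<^sup>2 + expectation (\<lambda>\<omega>. (Z \<omega> - m)\<^sup>2)"
    unfolding eq using Z i2 by (simp add: m_def prob_space)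
  finally show ?thesis by (simp add: m_def)
qed

section \<open>Second-order structure of the Wiener process\<close>

locale wiener =
  fixes M :: "'a measure" and W :: "real \<Rightarrow> 'a \<Rightarrow> real"
  assumes wiener: "wiener_process M W"

sublocale wiener \<subseteq> prob_space M
  using wiener by (simp add: wiener_process_def)

context wiener
begin

lemma W_measurable [measurable]: "0 \<le> t \<Longrightarrow> W t \<in> borel_measurable M"
  using wiener by (simp add: wiener_process_def)

lemma W_0: "AE \<omega> in M. W 0 \<omega> = 0"
  using wiener by (simp add: wiener_process_def)

lemma increments_indep:
  "0 \<le> t 0 \<Longrightarrow> (\<And>i. i < n \<Longrightarrow> t i < t (Suc i)) \<Longrightarrow>
    indep_vars (\<lambda>_. borel) (\<lambda>i \<omega>. W (t (Suc i)) \<omega> - W (t i) \<omega>) {..<n::nat}"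
  using wiener by (simp add: wiener_process_def)

lemma increment_distributed:
  assumes "0 \<le> s" "s < t"
  shows "distributed M lborel (\<lambda>\<omega>. W t \<omega> - W s \<omega>) (normal_density 0 (sqrt (t - s)))"
proof -
  have "\<forall>t\<ge>0. \<forall>h>0. distributed M lborel (\<lambda>\<omega>. W (t + h) \<omega> - W t \<omega>) (normal_density 0 (sqrt h))"
    using wiener by (simp add: wiener_process_def)
  from this[rule_format, of s "t - s"] show ?thesis using assms by simp
qed

lemma increment_moments:
  assumes "0 \<le> s" "s \<le> t"
  shows "integrable M (\<lambda>\<omega>. W t \<omega> - W s \<omega>)" "expectation (\<lambda>\<omega>. W t \<omega> - W s \<omega>) = 0"
    "integrable M (\<lambda>\<omega>. (W t \<omega> - W s \<omega>)\<^sup>2)" "expectation (\<lambda>\<omega>. (W t \<omega> - W s \<omega>)\<^sup>2) = t - s"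
proof -
  have "integrable M (\<lambda>\<omega>. W t \<omega> - W s \<omega>) \<and> expectation (\<lambda>\<omega>. W t \<omega> - W s \<omega>) = 0 \<and>
    integrable M (\<lambda>\<omega>. (W t \<omega> - W s \<omega>)\<^sup>2) \<and> expectation (\<lambda>\<omega>. (W t \<omega> - W s \<omega>)\<^sup>2) = t - s"
  proof (cases "s = t")
    case False
    then have lt: "s < t" using assms by simp
    note D = increment_distributed[OF assms(1) lt]
    have pos: "0 < sqrt (t - s)" using lt by simp
    have 1: "integrable M (\<lambda>\<omega>. W t \<omega> - W s \<omega>)"
      using integrable_normal_moment_nz_1[OF pos, of 0] distributed_integrable[OF D, of "\<lambda>x. x"] by simp
    have 2: "expectation (\<lambda>\<omega>. W t \<omega> - W s \<omega>) = 0"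
      using integral_normal_moment_nz_1[OF pos, of 0] distributed_integral[OF D, of "\<lambda>x. x"] by simp
    have 3: "integrable M (\<lambda>\<omega>. (W t \<omega> - W s \<omega>)\<^sup>2)"
      using integrable_normal_moment[OF pos, of 0 2] distributed_integrable[OF D, of "\<lambda>x. x\<^sup>2"] by simp
    have 4: "expectation (\<lambda>\<omega>. (W t \<omega> - W s \<omega>)\<^sup>2) = t - s"
      using normal_second_moment[OF D pos] lt by simp
    show ?thesis using 1 2 3 4 by blast
  qed simp
  then show "integrable M (\<lambda>\<omega>. W t \<omega> - W s \<omega>)" "expectation (\<lambda>\<omega>. W t \<omega> - W s \<omega>) = 0"
    "integrable M (\<lambda>\<omega>. (W t \<omega> - W s \<omega>)\<^sup>2)" "expectation (\<lambda>\<omega>. (W t \<omega> - W s \<omega>)\<^sup>2) = t - s" by auto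
qed

lemma W_square_moment:
  assumes "0 \<le> t"
  shows "integrable M (\<lambda>\<omega>. (W t \<omega>)\<^sup>2)" "expectation (\<lambda>\<omega>. (W t \<omega>)\<^sup>2) = t"
proof -
  have ae: "AE \<omega> in M. (W t \<omega> - W 0 \<omega>)\<^sup>2 = (W t \<omega>)\<^sup>2" using W_0 by eventually_elim simp
  have [measurable]: "W t \<in> borel_measurable M" "W 0 \<in> borel_measurable M" using assms by auto
  show "integrable M (\<lambda>\<omega>. (W t \<omega>)\<^sup>2)"
    using increment_moments(3)[of 0 t] assms integrable_cong_AE[OF _ _ ae] by simp
  show "expectation (\<lambda>\<omega>. (W t \<omega>)\<^sup>2) = t"
    using increment_moments(4)[of 0 t] assms integral_cong_AE[OF _ _ ae] by simp
qed

text \<open>Polarisation: the increment has variance \<open>\<bar>t - s\<bar>\<close>, and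
  \<open>t + s - \<bar>t - s\<bar> = 2 * min s t\<close>.\<close>

lemma W_covariance:
  assumes "0 \<le> s" "0 \<le> t"
  shows "integrable M (\<lambda>\<omega>. W s \<omega> * W t \<omega>)" "expectation (\<lambda>\<omega>. W s \<omega> * W t \<omega>) = min s t"
proof -
  have [measurable]: "W t \<in> borel_measurable M" "W s \<in> borel_measurable M" using assms by auto
  show int: "integrable M (\<lambda>\<omega>. W s \<omega> * W t \<omega>)"
    using assms by (intro integrable_mult_of_squares W_square_moment) auto
  have sq: "expectation (\<lambda>\<omega>. (W t \<omega> - W s \<omega>)\<^sup>2) = \<bar>t - s\<bar>"
    using increment_moments(4)[of s t] increment_moments(4)[of t s] assms
    by (cases "s \<le> t") (auto simp: power2_commute)
  have "expectation (\<lambda>\<omega>. (W t \<omega> - W s \<omega>)\<^sup>2) =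
    expectation (\<lambda>\<omega>. (W t \<omega>)\<^sup>2 + (W s \<omega>)\<^sup>2 - 2 * (W s \<omega> * W t \<omega>))"
    by (intro Bochner_Integration.integral_cong) (auto simp: power2_diff)
  also have "\<dots> = t + s - 2 * expectation (\<lambda>\<omega>. W s \<omega> * W t \<omega>)"
    using int W_square_moment assms by simp
  finally show "expectation (\<lambda>\<omega>. W s \<omega> * W t \<omega>) = min s t"
    using sq by (cases "s \<le> t") (auto simp: min_def)
qed

text \<open>The graph of the Wiener integral of deterministic step functions. Stated as a relation, it needs no
  choice of a partition; it is a function up to null sets by \<open>step_isometry\<close>.\<close>

inductive step_integral :: "(real \<Rightarrow> real) \<Rightarrow> ('a \<Rightarrow> real) \<Rightarrow> bool" where
  base: "0 \<le> t \<Longrightarrow> step_integral (indicator {0..<t}) (W t)"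
| scale: "step_integral \<phi> X \<Longrightarrow> step_integral (\<lambda>x. c * \<phi> x) (\<lambda>\<omega>. c * X \<omega>)"
| add: "step_integral \<phi> X \<Longrightarrow> step_integral \<psi> Y \<Longrightarrow> step_integral (\<lambda>x. \<phi> x + \<psi> x) (\<lambda>\<omega>. X \<omega> + Y \<omega>)"

lemma step_integral_diff:
  "step_integral \<phi> X \<Longrightarrow> step_integral \<psi> Y \<Longrightarrow> step_integral (\<lambda>x. \<phi> x - \<psi> x) (\<lambda>\<omega>. X \<omega> - Y \<omega>)"
  using add[OF _ scale[of \<psi> Y "-1"]] by simp

lemma step_integral_zero: "step_integral (\<lambda>_. 0) (\<lambda>_. 0)"
  using scale[OF base[of 0], of 0] by simp

lemma step_integral_sum:
  "(\<And>i. i \<in> I \<Longrightarrow> step_integral (\<phi> i) (X i)) \<Longrightarrow>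
    step_integral (\<lambda>x. \<Sum>i\<in>I. \<phi> i x) (\<lambda>\<omega>. \<Sum>i\<in>I. X i \<omega>)"
  by (induction I rule: infinite_finite_induct) (auto intro: step_integral_zero add)

lemma step_integral_increment:
  assumes "0 \<le> s" "s \<le> t"
  shows "step_integral (indicator {s..<t}) (\<lambda>\<omega>. W t \<omega> - W s \<omega>)"
proof -
  have "(\<lambda>x. indicator {0..<t} x - indicator {0..<s} x) = (indicator {s..<t} :: real \<Rightarrow> real)"
    using assms by (auto simp: indicator_def fun_eq_iff)
  then show ?thesis using step_integral_diff[OF base[of t] base[of s]] assms by simp
qed

lemma step_integral_measurable:
  assumes "step_integral \<phi> X"
  shows "\<phi> \<in> borel_measurable borel" "X \<in> borel_measurable M"
proof -
  have "\<phi> \<in> borel_measurable borel \<and> X \<in> borel_measurable M"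
    using assms by (induction) (auto intro: borel_measurable_times borel_measurable_add borel_measurable_indicator)
  then show "\<phi> \<in> borel_measurable borel" "X \<in> borel_measurable M" by auto
qed

text \<open>Covariance and inner product are both bilinear, so two inductions, one per argument,
  reduce their equality to two generators, where \<open>min s t\<close> is the length of
  \<open>{0..<s} \<inter> {0..<t}\<close>. Integrability is part of the claim because linearity of
  the integral asks for it in the inductive steps.\<close>

lemma step_covariance_base:
  assumes "step_integral \<phi> X" "0 \<le> t"
  shows "integrable M (\<lambda>\<omega>. X \<omega> * W t \<omega>) \<and> integrable lborel (\<lambda>x. \<phi> x * indicator {0..<t} x) \<and>
    expectation (\<lambda>\<omega>. X \<omega> * W t \<omega>) = (\<integral>x. \<phi> x * indicator {0..<t} x \<partial>lborel)"
  using assms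
proof (induction)
  case (base s)
  have eq: "(\<lambda>x. indicator {0..<s} x * indicator {0..<t} x :: real) = indicator {0..<min s t}"
    by (auto simp: indicator_def fun_eq_iff)
  show ?case unfolding eq using W_covariance[of s t] base by (auto simp: min_def)
next
  case (scale \<phi> X c)
  show ?case unfolding mult.assoc using scale by simp
next
  case (add \<phi> X \<phi>' X')
  show ?case unfolding distrib_right using add by simp
qed

lemma step_covariance:
  assumes "step_integral \<phi> X" "step_integral \<psi> Y"
  shows "integrable M (\<lambda>\<omega>. X \<omega> * Y \<omega>) \<and> integrable lborel (\<lambda>x. \<phi> x * \<psi> x) \<and>
    expectation (\<lambda>\<omega>. X \<omega> * Y \<omega>) = (\<integral>x. \<phi> x * \<psi> x \<partial>lborel)"
  using assms(2)
proof (induction)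
  case (base t)
  then show ?case using step_covariance_base[OF assms(1)] by simp
next
  case (scale \<psi> Y c)
  have eq: "X \<omega> * (c * Y \<omega>) = c * (X \<omega> * Y \<omega>)" "\<phi> x * (c * \<psi> x) = c * (\<phi> x * \<psi> x)" for \<omega> x
    by (rule mult.left_commute)+
  show ?case unfolding eq using scale.IH by simp
next
  case (add \<psi> Y \<psi>' Y')
  show ?case unfolding distrib_left using add.IH by simp
qed

lemma step_isometry:
  assumes "step_integral \<phi> X"
  shows "integrable M (\<lambda>\<omega>. (X \<omega>)\<^sup>2)" "integrable lborel (\<lambda>x. (\<phi> x)\<^sup>2)"
    "expectation (\<lambda>\<omega>. (X \<omega>)\<^sup>2) = (\<integral>x. (\<phi> x)\<^sup>2 \<partial>lborel)"
    "(\<integral>\<^sup>+\<omega>. ennreal ((X \<omega>)\<^sup>2) \<partial>M) = (\<integral>\<^sup>+x. ennreal ((\<phi> x)\<^sup>2) \<partial>lborel)"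
proof -
  show 1: "integrable M (\<lambda>\<omega>. (X \<omega>)\<^sup>2)" and 2: "integrable lborel (\<lambda>x. (\<phi> x)\<^sup>2)"
    and 3: "expectation (\<lambda>\<omega>. (X \<omega>)\<^sup>2) = (\<integral>x. (\<phi> x)\<^sup>2 \<partial>lborel)"
    using step_covariance[OF assms assms] unfolding power2_eq_square by blast+
  show "(\<integral>\<^sup>+\<omega>. ennreal ((X \<omega>)\<^sup>2) \<partial>M) = (\<integral>\<^sup>+x. ennreal ((\<phi> x)\<^sup>2) \<partial>lborel)"
    by (simp only: nn_integral_eq_integral[OF 1] nn_integral_eq_integral[OF 2] 3 zero_le_power2 AE_I2)
qed

end

section \<open>The Ito isometry\<close>

context wiener
begin

section \<open>Independence of an increment from the past\<close>

lemma space_natural_filtration [simp]: "space (natural_filtration M W s) = space M"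
  unfolding natural_filtration_def by (rule space_measure_of) auto

lemma sets_natural_filtration:
  "sets (natural_filtration M W s) =
    sigma_sets (space M) {W u -` A \<inter> space M | u A. u \<in> {0..s} \<and> A \<in> sets borel}"
  unfolding natural_filtration_def by (rule sets_measure_of) auto

lemma subalgebra_natural_filtration: "subalgebra M (natural_filtration M W s)"
  unfolding subalgebra_def sets_natural_filtration
  by (auto intro!: sets.sigma_sets_subset measurable_sets[OF W_measurable])

lemma natural_filtration_measurable_mono:
  assumes "Y \<in> borel_measurable (natural_filtration M W s)" "s \<le> s'"
  shows "Y \<in> borel_measurable (natural_filtration M W s')"
proof (rule measurable_from_subalg[OF _ assms(1)])
  show "subalgebra (natural_filtration M W s') (natural_filtration M W s)"
    unfolding subalgebra_def sets_natural_filtration using assms(2)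
    by (auto intro!: sigma_sets_mono') force
qed

lemma W_measurable_natural_filtration:
  assumes "0 \<le> u" "u \<le> s"
  shows "W u \<in> borel_measurable (natural_filtration M W s)"
proof (rule measurableI)
  fix A :: "real set" assume "A \<in> sets borel"
  then show "W u -` A \<inter> space (natural_filtration M W s) \<in> sets (natural_filtration M W s)"
    unfolding sets_natural_filtration space_natural_filtration using assms by (intro sigma_sets.Basic) auto
qed simp

text \<open>Independence is granted only for increments along an increasing sequence of times.
  Sorting \<open>U\<close> together with 0 and \<open>s\<close>, and appending \<open>t\<close>,
  gives such a sequence; each \<open>W u - W 0\<close> is then a sum of increments preceding the
  last one, and replacing \<open>W u\<close> by \<open>W u - W 0\<close> changes the cylinder by a
  null set only.\<close>

lemma past_cylinder_indep:
  assumes st: "0 \<le> s" "s < t" and U: "finite U" "U \<subseteq> {0..s}" and A: "\<And>u. A u \<in> sets borel"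
    and S: "S \<in> sets borel"
  shows "prob ({\<omega> \<in> space M. \<forall>u\<in>U. W u \<omega> \<in> A u} \<inter> ((\<lambda>\<omega>. W t \<omega> - W s \<omega>) -` S \<inter> space M)) =
    prob {\<omega> \<in> space M. \<forall>u\<in>U. W u \<omega> \<in> A u} * prob ((\<lambda>\<omega>. W t \<omega> - W s \<omega>) -` S \<inter> space M)"
proof -
  let ?F = "(\<lambda>\<omega>. W t \<omega> - W s \<omega>) -` S \<inter> space M"
  have [measurable]: "A u \<in> sets borel" "S \<in> sets borel" for u using A S by auto
  have [measurable]: "W t \<in> borel_measurable M" "W s \<in> borel_measurable M" "W 0 \<in> borel_measurable M"
    using st by auto
  have Um: "W u \<in> borel_measurable M" if "u \<in> U" for u using U that by auto
  obtain n q where q: "q ` {..n} = insert 0 (insert s U)" "\<And>i. i < n \<Longrightarrow> q i < q (Suc i)"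
    by (rule finite_set_increasing_enumeration[of "insert 0 (insert s U)"]) (use U in auto)
  have q_range: "0 \<le> q i \<and> q i \<le> s" if "i \<le> n" for i
    using that q(1) U(2) st by (metis (no_types, lifting) atLeastAtMost_iff atMost_iff image_eqI insert_iff order_refl subsetD)
  have q0: "q 0 = 0"
  proof -
    obtain i where "i \<le> n" "q i = 0" using q(1) by (metis atMost_iff imageE insertI1)
    then show ?thesis using increasing_steps_le[of n q 0 i] q(2) q_range[of 0] by auto
  qed
  have qn: "q n = s"
  proof -
    obtain i where "i \<le> n" "q i = s" using q(1) by (metis atMost_iff imageE insertI1 insertI2)
    then show ?thesis using increasing_steps_le[of n q i n] q(2) q_range[of n] by auto
  qed
  define r where "r i = (if i \<le> n then q i else t)" for i
  define D where "D i \<omega> = W (r (Suc i)) \<omega> - W (r i) \<omega>" for i \<omega>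
  have ind: "indep_vars (\<lambda>_. borel) D {..<Suc n}"
    unfolding D_def
  proof (rule increments_indep)
    show "r i < r (Suc i)" if "i < Suc n" for i
    proof (cases "i = n")
      case True then show ?thesis using qn st by (simp add: r_def)
    next
      case False then show ?thesis using that q(2)[of i] by (simp add: r_def)
    qed
  qed (simp add: r_def q0)
  have Dn: "D n \<omega> = W t \<omega> - W s \<omega>" for \<omega> by (simp add: D_def r_def qn)
  have "\<exists>i. i \<le> n \<and> q i = u" if "u \<in> U" for u
    using q(1) that by (metis atMost_iff imageE insertCI)
  then obtain idx where idx: "\<And>u. u \<in> U \<Longrightarrow> idx u \<le> n \<and> q (idx u) = u" by metis
  have tele: "(\<Sum>i<idx u. D i \<omega>) = W u \<omega> - W 0 \<omega>" if "u \<in> U" for u \<omega>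
    unfolding D_def using idx[OF that] sum_lessThan_telescope[of "\<lambda>i. W (r i) \<omega>" "idx u"]
    by (simp add: r_def q0)
  define EE where "EE = {x \<in> space (PiM {..<n} (\<lambda>_. borel :: real measure)). \<forall>u\<in>U. (\<Sum>i<idx u. x i) \<in> A u}"
  have EE: "EE \<in> sets (PiM {..<n} (\<lambda>_. borel))"
    unfolding EE_def
  proof (intro sets.sets_Collect_finite_All[OF _ U(1)])
    fix u assume "u \<in> U"
    then have [measurable]: "(\<lambda>x. \<Sum>i<idx u. x i) \<in> borel_measurable (PiM {..<n} (\<lambda>_. borel :: real measure))"
      using idx by (intro borel_measurable_sum measurable_component_singleton) (auto intro: less_le_trans)
    show "{x \<in> space (PiM {..<n} (\<lambda>_. borel :: real measure)). (\<Sum>i<idx u. x i) \<in> A u} \<in> sets (PiM {..<n} (\<lambda>_. borel))"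
      by measurable
  qed
  define E' where "E' = {\<omega> \<in> space M. \<forall>u\<in>U. W u \<omega> - W 0 \<omega> \<in> A u}"
  have E': "(\<lambda>\<omega>. restrict (\<lambda>i. D i \<omega>) {..<n}) -` EE \<inter> space M = E'"
  proof -
    have "(\<Sum>i<idx u. restrict (\<lambda>i. D i \<omega>) {..<n} i) = W u \<omega> - W 0 \<omega>" if "u \<in> U" for u \<omega>
      unfolding tele[OF that, symmetric] using idx[OF that] by (intro sum.cong) auto
    then show ?thesis by (auto simp: EE_def E'_def space_PiM)
  qed
  have "indep_var (PiM {..<n} (\<lambda>_. borel)) (\<lambda>\<omega>. restrict (\<lambda>i. D i \<omega>) {..<n})
     (PiM {n} (\<lambda>_. borel)) (\<lambda>\<omega>. restrict (\<lambda>i. D i \<omega>) {n})"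
    by (rule indep_var_restrict[OF ind]) auto
  moreover define FF where "FF = {x \<in> space (PiM {n} (\<lambda>_. borel :: real measure)). x n \<in> S}"
  moreover have "FF \<in> sets (PiM {n} (\<lambda>_. borel))" unfolding FF_def by measurable
  ultimately have "prob ((\<lambda>\<omega>. (restrict (\<lambda>i. D i \<omega>) {..<n}, restrict (\<lambda>i. D i \<omega>) {n})) -` (EE \<times> FF) \<inter> space M) =
      prob ((\<lambda>\<omega>. restrict (\<lambda>i. D i \<omega>) {..<n}) -` EE \<inter> space M) * prob ((\<lambda>\<omega>. restrict (\<lambda>i. D i \<omega>) {n}) -` FF \<inter> space M)"
    using EE by (intro indep_varD)
  moreover have F: "(\<lambda>\<omega>. restrict (\<lambda>i. D i \<omega>) {n}) -` FF \<inter> space M = ?F"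
    by (auto simp: FF_def space_PiM Dn)
  moreover have "(\<lambda>\<omega>. (restrict (\<lambda>i. D i \<omega>) {..<n}, restrict (\<lambda>i. D i \<omega>) {n})) -` (EE \<times> FF) \<inter> space M = E' \<inter> ?F"
    unfolding E'[symmetric] F[symmetric] by auto
  ultimately have main: "prob (E' \<inter> ?F) = prob E' * prob ?F" by (simp only: E')
  have Em: "{\<omega> \<in> space M. \<forall>u\<in>U. W u \<omega> \<in> A u} \<in> events" "E' \<in> events"
    unfolding E'_def using Um by (auto intro!: sets.sets_Collect_finite_All U(1))
  have ae: "AE \<omega> in M. (\<omega> \<in> {\<omega> \<in> space M. \<forall>u\<in>U. W u \<omega> \<in> A u}) = (\<omega> \<in> E')"
    using W_0 by eventually_elim (auto simp: E'_def)
  have "prob {\<omega> \<in> space M. \<forall>u\<in>U. W u \<omega> \<in> A u} = prob E'"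
    by (rule finite_measure_eq_AE[OF ae Em])
  moreover have "prob ({\<omega> \<in> space M. \<forall>u\<in>U. W u \<omega> \<in> A u} \<inter> ?F) = prob (E' \<inter> ?F)"
    using ae Em by (intro finite_measure_eq_AE) auto
  ultimately show ?thesis using main by simp
qed

text \<open>The preimages under a single \<open>W u\<close> that generate the past need not be
  closed under intersection. The cylinders over finitely many times are, and they include these
  preimages, so independence extends from cylinders to the whole sigma-algebra of the past.\<close>

lemma past_indep_increment:
  assumes st: "0 \<le> s" "s < t" and Y: "Y \<in> borel_measurable (natural_filtration M W s)"
  shows "indep_var borel Y borel (\<lambda>\<omega>. W t \<omega> - W s \<omega>)"
proof -
  define G where "G = {{\<omega> \<in> space M. \<forall>u\<in>U. W u \<omega> \<in> A u} | U A.
    finite U \<and> U \<subseteq> {0..s} \<and> (\<forall>u. A u \<in> sets borel)}"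
  define H where "H = {(\<lambda>\<omega>. W t \<omega> - W s \<omega>) -` S \<inter> space M | S. S \<in> sets borel}"
  have [measurable]: "W t \<in> borel_measurable M" "W s \<in> borel_measurable M" using st by auto
  have "G \<subseteq> events"
    unfolding G_def by (auto intro!: sets.sets_Collect_finite_All)
  moreover have "H \<subseteq> events" unfolding H_def by auto
  moreover have "prob (a \<inter> b) = prob a * prob b" if "a \<in> G" "b \<in> H" for a b
    using that past_cylinder_indep[OF st] by (auto simp: G_def H_def)
  ultimately have "indep_set G H" by (auto simp: indep_sets2_eq)
  moreover have "Int_stable G"
  proof (rule Int_stableI)
    fix a b assume "a \<in> G" "b \<in> G"
    then obtain U A V B where a: "a = {\<omega> \<in> space M. \<forall>u\<in>U. W u \<omega> \<in> A u}" "finite U" "U \<subseteq> {0..s}" "\<And>u. A u \<in> sets borel"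
      and b: "b = {\<omega> \<in> space M. \<forall>u\<in>V. W u \<omega> \<in> B u}" "finite V" "V \<subseteq> {0..s}" "\<And>u. B u \<in> sets borel"
      unfolding G_def by blast
    \<comment> \<open>Outside its own index set a cylinder imposes no condition, so both can be
      written over \<open>U \<union> V\<close>.\<close>
    define C where "C u = (if u \<in> U then A u else UNIV) \<inter> (if u \<in> V then B u else UNIV)" for u
    have "a \<inter> b = {\<omega> \<in> space M. \<forall>u\<in>U \<union> V. W u \<omega> \<in> C u}" by (auto simp: a b C_def)
    moreover have "C u \<in> sets borel" for u using a b by (auto simp: C_def)
    ultimately show "a \<inter> b \<in> G" unfolding G_def using a(2,3) b(2,3) by blast
  qed
  moreover have "Int_stable H"
  proof (rule Int_stableI)
    fix a b assume "a \<in> H" "b \<in> H"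
    then obtain S S' where "a = (\<lambda>\<omega>. W t \<omega> - W s \<omega>) -` S \<inter> space M" "S \<in> sets borel"
      "b = (\<lambda>\<omega>. W t \<omega> - W s \<omega>) -` S' \<inter> space M" "S' \<in> sets borel" unfolding H_def by blast
    then show "a \<inter> b \<in> H" unfolding H_def by (auto intro!: exI[of _ "S \<inter> S'"])
  qed
  ultimately have ind: "indep_set (sigma_sets (space M) G) (sigma_sets (space M) H)"
    by (rule indep_set_sigma_sets)
  have gen: "{W u -` A \<inter> space M | u A. u \<in> {0..s} \<and> A \<in> sets borel} \<subseteq> G"
  proof clarify
    fix u and A :: "real set" assume "u \<in> {0..s}" "A \<in> sets borel"
    then show "W u -` A \<inter> space M \<in> G"
      unfolding G_def by (intro CollectI exI[of _ "{u}"] exI[of _ "\<lambda>_. A"]) auto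
  qed
  have "{Y -` A \<inter> space M | A. A \<in> sets borel} \<subseteq> sets (natural_filtration M W s)"
    using measurable_sets[OF Y] by auto
  also have "\<dots> \<subseteq> sigma_sets (space M) G"
    unfolding sets_natural_filtration by (rule sigma_sets_mono'[OF gen])
  finally have "sigma_sets (space M) {Y -` A \<inter> space M | A. A \<in> sets borel} \<subseteq> sigma_sets (space M) G"
    by (rule sigma_sets_mono)
  then have "indep_set (sigma_sets (space M) {Y -` A \<inter> space M | A. A \<in> sets borel})
     (sigma_sets (space M) H)"
    using ind unfolding indep_sets2_eq by blast
  then show ?thesis
    unfolding indep_var_eq H_def using measurable_from_subalg[OF subalgebra_natural_filtration Y] by simp
qed

text \<open>In the expanded square an off-diagonal product is the later increment times a factor
  known when that increment starts, hence has expectation 0 by independence; a diagonal term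
  factorises into second moments. Boundedness of the coefficients makes all these products
  integrable.\<close>

lemma elementary_isometry:
  fixes n :: nat
  assumes t: "0 \<le> t 0" "\<And>i. i < n \<Longrightarrow> t i < t (Suc i)"
    and \<eta>: "\<And>i. i < n \<Longrightarrow> \<eta> i \<in> borel_measurable (natural_filtration M W (t i))"
    and bdd: "\<And>i. i < n \<Longrightarrow> \<exists>c. \<forall>\<omega>\<in>space M. \<bar>\<eta> i \<omega>\<bar> \<le> c"
  shows "(\<integral>\<^sup>+\<omega>. ennreal ((\<Sum>i<n. \<eta> i \<omega> * (W (t (Suc i)) \<omega> - W (t i) \<omega>))\<^sup>2) \<partial>M) =
    ennreal (\<Sum>i<n. expectation (\<lambda>\<omega>. (\<eta> i \<omega>)\<^sup>2) * (t (Suc i) - t i))"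
proof -
  define D where "D i \<omega> = W (t (Suc i)) \<omega> - W (t i) \<omega>" for i \<omega>
  have t0: "0 \<le> t i" if "i \<le> n" for i
    using increasing_steps_le[of n t 0 i] t that by auto
  have D_meas [measurable]: "D i \<in> borel_measurable M" if "i < n" for i
    using that t0 unfolding D_def by auto
  have \<eta>_meas [measurable]: "\<eta> i \<in> borel_measurable M" if "i < n" for i
    using measurable_from_subalg[OF subalgebra_natural_filtration \<eta>[OF that]] .
  have D_int: "integrable M (D i)" "expectation (D i) = 0" "integrable M (\<lambda>\<omega>. (D i \<omega>)\<^sup>2)"
    "expectation (\<lambda>\<omega>. (D i \<omega>)\<^sup>2) = t (Suc i) - t i" if "i < n" for i
    using increment_moments[of "t i" "t (Suc i)"] t0[of i] t(2)[OF that] that unfolding D_def by auto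
  have bmult: "integrable M (\<lambda>\<omega>. \<eta> i \<omega> * Z \<omega>)" if i: "i < n" and Z: "integrable M Z" for i Z
  proof -
    obtain c where c: "\<And>\<omega>. \<omega> \<in> space M \<Longrightarrow> \<bar>\<eta> i \<omega>\<bar> \<le> c" using bdd[OF i] by auto
    show ?thesis
    proof (rule Bochner_Integration.integrable_bound[of _ "\<lambda>\<omega>. c * Z \<omega>"])
      show "integrable M (\<lambda>\<omega>. c * Z \<omega>)" using Z by simp
      show "(\<lambda>\<omega>. \<eta> i \<omega> * Z \<omega>) \<in> borel_measurable M" using \<eta>_meas[OF i] Z by auto
      show "AE \<omega> in M. norm (\<eta> i \<omega> * Z \<omega>) \<le> norm (c * Z \<omega>)"
      proof (rule AE_I2)
        fix \<omega> assume "\<omega> \<in> space M"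
        then have "\<bar>\<eta> i \<omega>\<bar> \<le> \<bar>c\<bar>" using c[of \<omega>] by linarith
        then show "norm (\<eta> i \<omega> * Z \<omega>) \<le> norm (c * Z \<omega>)" by (simp add: abs_mult mult_right_mono)
      qed
    qed
  qed
  have \<eta>2: "integrable M (\<lambda>\<omega>. (\<eta> i \<omega>)\<^sup>2)" if "i < n" for i
    using bmult[OF that bmult[OF that, of "\<lambda>_. 1"]] by (simp add: power2_eq_square)
  define T where "T i j \<omega> = (\<eta> i \<omega> * D i \<omega>) * (\<eta> j \<omega> * D j \<omega>)" for i j \<omega>
  have T_sym: "T i j = T j i" for i j by (auto simp: T_def fun_eq_iff)
  have off: "integrable M (T i j) \<and> expectation (T i j) = 0" if ij: "i < j" "j < n" for i j
  proof -
    define Y where "Y \<omega> = \<eta> j \<omega> * (\<eta> i \<omega> * D i \<omega>)" for \<omega>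
    have tt: "t i \<le> t j" "t (Suc i) \<le> t j" using increasing_steps_le[of n t] t(2) ij by auto
    have [measurable]: "\<eta> j \<in> borel_measurable (natural_filtration M W (t j))"
      "\<eta> i \<in> borel_measurable (natural_filtration M W (t j))"
      "W (t i) \<in> borel_measurable (natural_filtration M W (t j))"
      "W (t (Suc i)) \<in> borel_measurable (natural_filtration M W (t j))"
      using \<eta>[of j] natural_filtration_measurable_mono[OF \<eta>[of i] tt(1)] ij tt t0
      by (auto intro!: W_measurable_natural_filtration)
    have "Y \<in> borel_measurable (natural_filtration M W (t j))"
      unfolding Y_def D_def by measurable
    then have ind: "indep_var borel Y borel (D j)"
      unfolding D_def using t(2)[OF ij(2)] t0[of j] ij by (intro past_indep_increment) auto
    have "integrable M Y" unfolding Y_def using ij D_int by (intro bmult) auto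
    moreover have "T i j = (\<lambda>\<omega>. Y \<omega> * D j \<omega>)" by (auto simp: T_def Y_def fun_eq_iff)
    ultimately show ?thesis
      using indep_var_lebesgue_integral[OF ind] indep_var_integrable[OF ind] D_int[OF ij(2)] by simp
  qed
  have diag: "integrable M (T i i) \<and> expectation (T i i) = expectation (\<lambda>\<omega>. (\<eta> i \<omega>)\<^sup>2) * (t (Suc i) - t i)"
    if i: "i < n" for i
  proof -
    have "indep_var borel (\<eta> i) borel (D i)"
      unfolding D_def using t(2)[OF i] t0[of i] i by (intro past_indep_increment \<eta>) auto
    then have ind: "indep_var borel (\<lambda>\<omega>. (\<eta> i \<omega>)\<^sup>2) borel (\<lambda>\<omega>. (D i \<omega>)\<^sup>2)"
      using indep_var_compose[of borel "\<eta> i" borel "D i" "\<lambda>x. x\<^sup>2" borel "\<lambda>x. x\<^sup>2" borel] by (simp add: comp_def)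
    have "T i i = (\<lambda>\<omega>. (\<eta> i \<omega>)\<^sup>2 * (D i \<omega>)\<^sup>2)" by (auto simp: T_def fun_eq_iff power2_eq_square)
    then show ?thesis
      using indep_var_lebesgue_integral[OF ind] indep_var_integrable[OF ind] \<eta>2[OF i] D_int[OF i] by simp
  qed
  have T: "integrable M (T i j)"
    "expectation (T i j) = (if i = j then expectation (\<lambda>\<omega>. (\<eta> i \<omega>)\<^sup>2) * (t (Suc i) - t i) else 0)"
    if "i < n" "j < n" for i j
    using off[of i j] off[of j i] diag[of i] that T_sym[of i j] by (cases i j rule: linorder_cases; auto)+
  have sq: "(\<Sum>i<n. \<eta> i \<omega> * (W (t (Suc i)) \<omega> - W (t i) \<omega>))\<^sup>2 = (\<Sum>i<n. \<Sum>j<n. T i j \<omega>)" for \<omega>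
    by (simp add: power2_eq_square sum_product T_def D_def)
  have "integrable M (\<lambda>\<omega>. \<Sum>i<n. \<Sum>j<n. T i j \<omega>)" using T by (intro Bochner_Integration.integrable_sum) auto
  moreover have "expectation (\<lambda>\<omega>. \<Sum>i<n. \<Sum>j<n. T i j \<omega>) = (\<Sum>i<n. \<Sum>j<n. expectation (T i j))"
    using T by (subst Bochner_Integration.integral_sum) (auto intro!: sum.cong Bochner_Integration.integral_sum)
  moreover have "\<dots> = (\<Sum>i<n. expectation (\<lambda>\<omega>. (\<eta> i \<omega>)\<^sup>2) * (t (Suc i) - t i))"
    using T by (auto intro!: sum.cong)
  ultimately show ?thesis
    unfolding sq by (subst nn_integral_eq_integral) (auto simp: sq[symmetric])
qed

end

section \<open>Deterministic approximation of the Ito integral\<close>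

text \<open>The coefficients are quantified inside each case, so that one case distinction on
  \<open>x\<close> evaluates the sums for several coefficient families at once.\<close>

lemma sum_disjoint_indicator_cases:
  fixes t :: "nat \<Rightarrow> real" and n :: nat
  assumes "\<And>i. i < n \<Longrightarrow> t i < t (Suc i)"
  obtains "\<And>i. i < n \<Longrightarrow> x \<notin> {t i..<t (Suc i)}" "\<And>z :: nat \<Rightarrow> real. (\<Sum>i<n. z i * indicator {t i..<t (Suc i)} x) = 0"
  | k where "k < n" "x \<in> {t k..<t (Suc k)}" "\<And>z :: nat \<Rightarrow> real. (\<Sum>i<n. z i * indicator {t i..<t (Suc i)} x) = z k"
proof (cases "\<exists>k<n. x \<in> {t k..<t (Suc k)}")
  case True
  then obtain k where k: "k < n" "x \<in> {t k..<t (Suc k)}" by blast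
  have "x \<notin> {t i..<t (Suc i)}" if "i < n" "i \<noteq> k" for i
    using that k increasing_steps_le[of n t "Suc i" k] increasing_steps_le[of n t "Suc k" i] assms
    by (cases i k rule: linorder_cases) (auto simp: not_le not_less)
  then have "(\<Sum>i<n. z i * indicator {t i..<t (Suc i)} x) = (\<Sum>i<n. if i = k then z i else 0)" for z :: "nat \<Rightarrow> real"
    using k by (intro sum.cong) (auto simp: indicator_def)
  then show ?thesis using that(2)[OF k] k(1) by (simp add: sum.delta)
next
  case False
  then have "(\<Sum>i<n. z i * indicator {t i..<t (Suc i)} x) = 0" for z :: "nat \<Rightarrow> real"
    by (intro sum.neutral) (auto simp: indicator_def)
  with False show ?thesis by (intro that(1)) auto
qed

context wiener
begin

text \<open>A section of a jointly measurable function is measurable, and a point at which to take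
  it exists since \<open>M\<close> is a probability space.\<close>

lemma ito_deterministic_integrand_measurable:
  assumes "is_ito_integral M W T (\<lambda>x \<omega>. f x) Y"
  shows "(\<lambda>x. f x * indicator {0..T} x) \<in> borel_measurable borel"
proof -
  have f_joint: "(\<lambda>(x, \<omega>::'a). f x) \<in> borel_measurable (restrict_space borel {0..T} \<Otimes>\<^sub>M M)"
    using assms unfolding is_ito_integral_def ito_integrable_def by auto
  obtain \<omega>0 where \<omega>0: "\<omega>0 \<in> space M" using not_empty by auto
  have "(\<lambda>x. (\<lambda>(x, \<omega>::'a). f x) (x, \<omega>0)) \<in> borel_measurable (restrict_space borel {0..T})"
    by (rule measurable_compose[OF _ f_joint]) (use \<omega>0 in auto)
  then have "f \<in> borel_measurable (restrict_space borel {0..T})" by simp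
  then show ?thesis by (simp add: borel_measurable_restrict_space_iff mult.commute)
qed

text \<open>The integrand being deterministic, replacing the coefficients of an approximating elementary process
  by their expectations only improves the approximation, and by the isometry it moves the elementary
  integral by no more than the approximation error.\<close>

lemma ito_deterministic_approx:
  assumes ito: "is_ito_integral M W T (\<lambda>x \<omega>. f x) Y" and T: "0 \<le> T" and e: "0 < (e::real)"
  obtains n t c where "t 0 = 0" "t n = T" "\<And>i. i < n \<Longrightarrow> t i < t (Suc i)"
    "(\<integral>\<^sup>+x\<in>{0..T}. ennreal ((f x - (\<Sum>i<n. c i * indicator {t i..<t (Suc i)} x))\<^sup>2) \<partial>lborel) < ennreal e"
    "(\<integral>\<^sup>+\<omega>. ennreal ((Y \<omega> - (\<Sum>i<n. c i * (W (t (Suc i)) \<omega> - W (t i) \<omega>)))\<^sup>2) \<partial>M) < ennreal e"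
proof -
  have Y[measurable]: "Y \<in> borel_measurable M" using ito by (simp add: is_ito_integral_def)
  define g where "g x = f x * indicator {0..T} x" for x
  have g[measurable]: "g \<in> borel_measurable borel"
    using ito_deterministic_integrand_measurable[OF ito] by (simp add: g_def[abs_def])
  have fg: "f x = g x" if "x \<in> {0..T}" for x using that by (simp add: g_def)
  obtain N \<tau> \<Xi> where el: "\<And>k. elementary_integrand M W T (N k) (\<tau> k) (\<Xi> k)"
    and lim1: "(\<lambda>k. \<integral>\<^sup>+\<omega>. (\<integral>\<^sup>+x\<in>{0..T}.
            ennreal ((f x - elementary_process (N k) (\<tau> k) (\<Xi> k) x \<omega>)\<^sup>2) \<partial>lborel) \<partial>M) \<longlonglongrightarrow> 0"
    and lim2: "(\<lambda>k. \<integral>\<^sup>+\<omega>. ennreal ((Y \<omega> - elementary_integral W (N k) (\<tau> k) (\<Xi> k) \<omega>)\<^sup>2) \<partial>M) \<longlonglongrightarrow> 0"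
    using ito unfolding is_ito_integral_def by blast
  \<comment> \<open>A quarter for each error, because the final estimate doubles both the error of
    \<open>Y\<close> and the isometry term.\<close>
  have "0 < ennreal (e / 4)" using e by simp
  then have "\<forall>\<^sub>F k in sequentially. (\<integral>\<^sup>+\<omega>. (\<integral>\<^sup>+x\<in>{0..T}.
            ennreal ((f x - elementary_process (N k) (\<tau> k) (\<Xi> k) x \<omega>)\<^sup>2) \<partial>lborel) \<partial>M) < ennreal (e / 4) \<and>
      (\<integral>\<^sup>+\<omega>. ennreal ((Y \<omega> - elementary_integral W (N k) (\<tau> k) (\<Xi> k) \<omega>)\<^sup>2) \<partial>M) < ennreal (e / 4)"
    using order_tendstoD(2)[OF lim1] order_tendstoD(2)[OF lim2] by (intro eventually_conj) auto
  then obtain k where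
    A: "(\<integral>\<^sup>+\<omega>. (\<integral>\<^sup>+x\<in>{0..T}. ennreal ((f x - elementary_process (N k) (\<tau> k) (\<Xi> k) x \<omega>)\<^sup>2) \<partial>lborel) \<partial>M) < ennreal (e / 4)"
    and B: "(\<integral>\<^sup>+\<omega>. ennreal ((Y \<omega> - elementary_integral W (N k) (\<tau> k) (\<Xi> k) \<omega>)\<^sup>2) \<partial>M) < ennreal (e / 4)"
    by (auto dest!: eventually_happens)
  define n t \<xi> where "n = N k" and "t = \<tau> k" and "\<xi> = \<Xi> k"
  have t: "t 0 = 0" "t n = T" "\<And>i. i < n \<Longrightarrow> t i < t (Suc i)"
    and \<xi>: "\<And>i. i < n \<Longrightarrow> \<xi> i \<in> borel_measurable (natural_filtration M W (t i))"
    and bdd: "\<And>i. i < n \<Longrightarrow> \<exists>c. \<forall>\<omega>\<in>space M. \<bar>\<xi> i \<omega>\<bar> \<le> c"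
    using el[of k] unfolding elementary_integrand_def n_def t_def \<xi>_def by auto
  have \<xi>_meas[measurable]: "\<xi> i \<in> borel_measurable M" if "i < n" for i
    using measurable_from_subalg[OF subalgebra_natural_filtration \<xi>[OF that]] .
  have t0: "0 \<le> t i" if "i \<le> n" for i using increasing_steps_le[of n t 0 i] t that by auto
  define c where "c i = expectation (\<xi> i)" for i
  define V where "V i = expectation (\<lambda>\<omega>. (\<xi> i \<omega> - c i)\<^sup>2)" for i
  define \<phi> where "\<phi> x = (\<Sum>i<n. c i * indicator {t i..<t (Suc i)} x)" for x
  define v where "v x = (\<Sum>i<n. V i * indicator {t i..<t (Suc i)} x)" for x
  have V: "0 \<le> V i" for i unfolding V_def by simp
  have v0: "0 \<le> v x" for x unfolding v_def using V by (intro sum_nonneg) auto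
  have [measurable]: "\<phi> \<in> borel_measurable borel" "v \<in> borel_measurable borel"
    unfolding \<phi>_def[abs_def] v_def[abs_def] by measurable
  \<comment> \<open>For fixed \<open>x\<close> at most one coefficient is active, and averaging over
    \<omega> splits the squared error into the deterministic error of \<phi> and the variance
    \<open>v\<close>.\<close>
  have pt: "(\<integral>\<^sup>+\<omega>. ennreal ((g x - elementary_process n t \<xi> x \<omega>)\<^sup>2) \<partial>M) = ennreal ((g x - \<phi> x)\<^sup>2 + v x)" for x
  proof (rule sum_disjoint_indicator_cases[of n t x, OF t(3)])
    assume "\<And>i. i < n \<Longrightarrow> x \<notin> {t i..<t (Suc i)}" "\<And>z :: nat \<Rightarrow> real. (\<Sum>i<n. z i * indicator {t i..<t (Suc i)} x) = 0"
    then show ?thesis by (simp add: elementary_process_def \<phi>_def v_def emeasure_space_1)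
  next
    fix k assume k: "k < n" "x \<in> {t k..<t (Suc k)}" "\<And>z :: nat \<Rightarrow> real. (\<Sum>i<n. z i * indicator {t i..<t (Suc i)} x) = z k"
    obtain b where b: "\<And>\<omega>. \<omega> \<in> space M \<Longrightarrow> \<bar>\<xi> k \<omega>\<bar> \<le> b" using bdd[OF k(1)] by auto
    show ?thesis
      unfolding elementary_process_def \<phi>_def v_def k(3) V_def c_def
      by (rule bounded_variance_decomposition[OF \<xi>_meas[OF k(1)] b])
  qed
  \<comment> \<open>After Fubini the pointwise identity is integrated over time: the given
    approximation error is the squared distance of \<phi> from \<open>f\<close> plus the accumulated
    variance, and so bounds both.\<close>
  interpret P: pair_sigma_finite lborel M
    by unfold_locales
  have "(\<integral>\<^sup>+\<omega>. (\<integral>\<^sup>+x\<in>{0..T}. ennreal ((f x - elementary_process n t \<xi> x \<omega>)\<^sup>2) \<partial>lborel) \<partial>M) =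
    (\<integral>\<^sup>+\<omega>. (\<integral>\<^sup>+x. ennreal ((g x - elementary_process n t \<xi> x \<omega>)\<^sup>2) * indicator {0..T} x \<partial>lborel) \<partial>M)"
    by (intro nn_integral_cong) (auto simp: indicator_def fg)
  also have "\<dots> = (\<integral>\<^sup>+x. (\<integral>\<^sup>+\<omega>. ennreal ((g x - elementary_process n t \<xi> x \<omega>)\<^sup>2) * indicator {0..T} x \<partial>M) \<partial>lborel)"
    unfolding elementary_process_def by (rule P.Fubini') measurable
  also have "\<dots> = (\<integral>\<^sup>+x. ennreal ((g x - \<phi> x)\<^sup>2 + v x) * indicator {0..T} x \<partial>lborel)"
    unfolding pt[symmetric] elementary_process_def by (intro nn_integral_cong nn_integral_multc) measurable
  also have "\<dots> = (\<integral>\<^sup>+x. ennreal ((g x - \<phi> x)\<^sup>2) * indicator {0..T} x + ennreal (v x) * indicator {0..T} x \<partial>lborel)"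
    using v0 by (intro nn_integral_cong) (auto simp: indicator_def)
  also have "\<dots> = (\<integral>\<^sup>+x. ennreal ((g x - \<phi> x)\<^sup>2) * indicator {0..T} x \<partial>lborel) +
      (\<integral>\<^sup>+x. ennreal (v x) * indicator {0..T} x \<partial>lborel)"
    by (intro nn_integral_add) measurable
  also have "(\<integral>\<^sup>+x. ennreal ((g x - \<phi> x)\<^sup>2) * indicator {0..T} x \<partial>lborel) =
      (\<integral>\<^sup>+x\<in>{0..T}. ennreal ((f x - \<phi> x)\<^sup>2) \<partial>lborel)"
    by (intro nn_integral_cong) (auto simp: indicator_def fg)
  also have "(\<integral>\<^sup>+x. ennreal (v x) * indicator {0..T} x \<partial>lborel) = ennreal (\<Sum>i<n. V i * (t (Suc i) - t i))"
  proof -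
    have "(\<integral>\<^sup>+x. ennreal (v x) * indicator {0..T} x \<partial>lborel) =
      (\<integral>\<^sup>+x. (\<Sum>i<n. ennreal (V i) * indicator {t i..<t (Suc i)} x) \<partial>lborel)"
    proof (rule nn_integral_cong)
      fix x
      have "v x = 0" if "x \<notin> {0..T}"
        unfolding v_def
      proof (intro sum.neutral ballI)
        fix i assume "i \<in> {..<n}"
        then have "0 \<le> t i" "t (Suc i) \<le> T" using t0[of i] increasing_steps_le[of n t "Suc i" n] t by auto
        then show "V i * indicator {t i..<t (Suc i)} x = 0" using that by (auto simp: indicator_def)
      qed
      then have "ennreal (v x) * indicator {0..T} x = ennreal (v x)" by (auto simp: indicator_def)
      also have "\<dots> = (\<Sum>i<n. ennreal (V i * indicator {t i..<t (Suc i)} x))"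
        unfolding v_def using V by (intro sum_ennreal[symmetric]) auto
      finally show "ennreal (v x) * indicator {0..T} x = (\<Sum>i<n. ennreal (V i) * indicator {t i..<t (Suc i)} x)"
        using V by (simp add: ennreal_mult ennreal_indicator)
    qed
    also have "\<dots> = (\<Sum>i<n. ennreal (V i) * emeasure lborel {t i..<t (Suc i)})"
      by (subst nn_integral_sum) (auto simp: nn_integral_cmult_indicator)
    also have "\<dots> = (\<Sum>i<n. ennreal (V i * (t (Suc i) - t i)))"
      using t(3) V by (intro sum.cong) (auto simp: ennreal_mult less_imp_le)
    also have "\<dots> = ennreal (\<Sum>i<n. V i * (t (Suc i) - t i))"
      using t(3) V by (intro sum_ennreal) (auto simp: less_imp_le)
    finally show ?thesis .
  qed
  finally have A_eq: "(\<integral>\<^sup>+x\<in>{0..T}. ennreal ((f x - \<phi> x)\<^sup>2) \<partial>lborel) + ennreal (\<Sum>i<n. V i * (t (Suc i) - t i)) < ennreal (e / 4)"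
    using A unfolding n_def t_def \<xi>_def by simp
  have "(\<integral>\<^sup>+x\<in>{0..T}. ennreal ((f x - \<phi> x)\<^sup>2) \<partial>lborel) < ennreal (e / 4)"
    by (rule le_less_trans[OF _ A_eq]) simp
  also have "\<dots> \<le> ennreal e" using e by (intro ennreal_leI) auto
  finally have 1: "(\<integral>\<^sup>+x\<in>{0..T}. ennreal ((f x - \<phi> x)\<^sup>2) \<partial>lborel) < ennreal e" .
  \<comment> \<open>The accumulated variance is also the second moment of the change that centring
    the coefficients makes to the elementary integral.\<close>
  have iso: "(\<integral>\<^sup>+\<omega>. ennreal ((\<Sum>i<n. (\<xi> i \<omega> - c i) * (W (t (Suc i)) \<omega> - W (t i) \<omega>))\<^sup>2) \<partial>M) =
    ennreal (\<Sum>i<n. V i * (t (Suc i) - t i))"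
    unfolding V_def
  proof (rule elementary_isometry)
    fix i assume i: "i < n"
    show "(\<lambda>\<omega>. \<xi> i \<omega> - c i) \<in> borel_measurable (natural_filtration M W (t i))" using \<xi>[OF i] by simp
    obtain b where b: "\<And>\<omega>. \<omega> \<in> space M \<Longrightarrow> \<bar>\<xi> i \<omega>\<bar> \<le> b" using bdd[OF i] by auto
    have "\<bar>\<xi> i \<omega> - c i\<bar> \<le> b + \<bar>c i\<bar>" if "\<omega> \<in> space M" for \<omega> using b[OF that] by linarith
    then show "\<exists>b. \<forall>\<omega>\<in>space M. \<bar>\<xi> i \<omega> - c i\<bar> \<le> b" by blast
  qed (use t in auto)
  have Wm[measurable]: "W (t i) \<in> borel_measurable M" "W (t (Suc i)) \<in> borel_measurable M" if "i < n" for i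
    using t0[of i] t0[of "Suc i"] that by auto
  have "(\<integral>\<^sup>+\<omega>. ennreal ((Y \<omega> - (\<Sum>i<n. c i * (W (t (Suc i)) \<omega> - W (t i) \<omega>)))\<^sup>2) \<partial>M) =
    (\<integral>\<^sup>+\<omega>. ennreal (((Y \<omega> - (\<Sum>i<n. \<xi> i \<omega> * (W (t (Suc i)) \<omega> - W (t i) \<omega>))) +
      (\<Sum>i<n. (\<xi> i \<omega> - c i) * (W (t (Suc i)) \<omega> - W (t i) \<omega>)))\<^sup>2) \<partial>M)"
    by (simp add: left_diff_distrib sum_subtractf)
  also have "\<dots> \<le> 2 * (\<integral>\<^sup>+\<omega>. ennreal ((Y \<omega> - (\<Sum>i<n. \<xi> i \<omega> * (W (t (Suc i)) \<omega> - W (t i) \<omega>)))\<^sup>2) \<partial>M) +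
     2 * (\<integral>\<^sup>+\<omega>. ennreal ((\<Sum>i<n. (\<xi> i \<omega> - c i) * (W (t (Suc i)) \<omega> - W (t i) \<omega>))\<^sup>2) \<partial>M)"
    by (rule nn_integral_square_add_le) measurable
  also have "\<dots> \<le> 2 * ennreal (e / 4) + 2 * ennreal (\<Sum>i<n. V i * (t (Suc i) - t i))"
    unfolding iso using B unfolding elementary_integral_def n_def t_def \<xi>_def
    by (intro add_right_mono mult_left_mono) auto
  also have "\<dots> < 2 * ennreal (e / 4) + 2 * ennreal (e / 4)"
  proof -
    have "ennreal (\<Sum>i<n. V i * (t (Suc i) - t i)) < ennreal (e / 4)"
      by (rule le_less_trans[OF _ A_eq]) simp
    then show ?thesis
      by (intro ennreal_add_left_cancel_less[THEN iffD2] conjI ennreal_mult_strict_left_mono)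
        (auto simp: ennreal_mult_eq_top_iff)
  qed
  also have "\<dots> = ennreal e"
    using e by (simp add: ennreal_mult'[symmetric] ennreal_plus[symmetric] del: ennreal_plus flip: ennreal_numeral)
  finally have 2: "(\<integral>\<^sup>+\<omega>. ennreal ((Y \<omega> - (\<Sum>i<n. c i * (W (t (Suc i)) \<omega> - W (t i) \<omega>)))\<^sup>2) \<partial>M) < ennreal e" .
  show ?thesis using that[OF t 1[unfolded \<phi>_def] 2] .
qed

end

section \<open>Independence of step integrals\<close>

lemma increasing_steps_cover:
  fixes q :: "nat \<Rightarrow> real"
  assumes "q 0 \<le> x" "x < q m"
  shows "\<exists>k<m. x \<in> {q k..<q (Suc k)}"
  using assms
proof (induction m)
  case (Suc m)
  then show ?case by (cases "x < q m") (auto intro: less_SucI)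
qed simp

context wiener
begin

text \<open>A common refinement \<open>Q\<close> of all partitions makes every \<open>D j\<close> a
  combination of increments of \<open>W\<close> over cells of \<open>Q\<close>. Disjoint intervals
  use disjoint sets of cells, hence independence. Sums of independent normal variables are normal,
  and the variance is read off from the isometry.\<close>

lemma step_integrals_indep_normal:
  fixes S :: "'b set" and s t :: "'b \<Rightarrow> real" and c p :: "nat \<Rightarrow> real" and n :: nat
  assumes S: "finite S" "\<And>j. j \<in> S \<Longrightarrow> 0 \<le> s j" "\<And>j. j \<in> S \<Longrightarrow> 0 \<le> t j"
    and disj: "disjoint_family_on (\<lambda>j. {s j..<t j}) S"
    and p: "\<And>i. i \<le> n \<Longrightarrow> 0 \<le> p i"
    and \<phi>: "\<phi> = (\<lambda>x. \<Sum>i<n. c i * indicator {p i..<p (Suc i)} x)"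
  obtains D where "indep_vars (\<lambda>_. borel) D S"
    "\<And>j. j \<in> S \<Longrightarrow> step_integral (\<lambda>x. \<phi> x * indicator {s j..<t j} x) (D j)"
    "\<And>j. j \<in> S \<Longrightarrow> 0 < (\<integral>x. (\<phi> x * indicator {s j..<t j} x)\<^sup>2 \<partial>lborel) \<Longrightarrow>
      distributed M lborel (D j) (normal_density 0 (sqrt (\<integral>x. (\<phi> x * indicator {s j..<t j} x)\<^sup>2 \<partial>lborel)))"
proof -
  define Q where "Q = insert 0 (p ` {..n} \<union> s ` S \<union> t ` S)"
  obtain m q where q: "q ` {..m} = Q" "\<And>i. i < m \<Longrightarrow> q i < q (Suc i)"
    by (rule finite_set_increasing_enumeration[of Q]) (use S in \<open>auto simp: Q_def\<close>)
  have q0: "0 \<le> q i" if "i \<le> m" for i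
  proof -
    have "q i \<in> Q" using that q(1) by blast
    then show ?thesis using S p by (auto simp: Q_def)
  qed
  have Qq: "\<exists>l\<le>m. y = q l" if "y \<in> Q" for y using that q(1) by blast
  define \<Delta> where "\<Delta> i \<omega> = W (q (Suc i)) \<omega> - W (q i) \<omega>" for i \<omega>
  have ind\<Delta>: "indep_vars (\<lambda>_. borel) \<Delta> {..<m}"
    unfolding \<Delta>_def by (rule increments_indep) (use q0 q(2) in auto)
  define K where "K j = {i. i < m \<and> q i \<in> {s j..<t j}}" for j
  have finK: "finite (K j)" for j unfolding K_def by auto
  define D where "D j \<omega> = (\<Sum>i\<in>K j. \<phi> (q i) * \<Delta> i \<omega>)" for j \<omega>
  have "indep_vars (\<lambda>j. PiM (K j) (\<lambda>_. borel)) (\<lambda>j \<omega>. restrict (\<lambda>i. \<Delta> i \<omega>) (K j)) S"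
  proof (rule indep_vars_restrict[OF ind\<Delta>])
    show "disjoint_family_on K S"
      using disj unfolding disjoint_family_on_def K_def by blast
  qed (auto simp: K_def)
  then have "indep_vars (\<lambda>_. borel) (\<lambda>j \<omega>. (\<lambda>x. \<Sum>i\<in>K j. \<phi> (q i) * x i) (restrict (\<lambda>i. \<Delta> i \<omega>) (K j))) S"
  proof (rule indep_vars_compose2)
    fix j
    show "(\<lambda>x. \<Sum>i\<in>K j. \<phi> (q i) * x i) \<in> borel_measurable (PiM (K j) (\<lambda>_. borel))"
      by (intro borel_measurable_sum borel_measurable_times borel_measurable_const measurable_component_singleton)
  qed
  then have indD: "indep_vars (\<lambda>_. borel) D S"
    by (simp add: D_def[abs_def] cong: sum.cong)
  have step: "step_integral (\<lambda>x. \<phi> x * indicator {s j..<t j} x) (D j)" if j: "j \<in> S" for j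
  proof -
    have inQ: "s j \<in> Q" "t j \<in> Q" "\<And>i. i \<le> n \<Longrightarrow> p i \<in> Q" using j by (auto simp: Q_def)
    have "\<phi> x * indicator {s j..<t j} x = (\<Sum>i\<in>K j. \<phi> (q i) * indicator {q i..<q (Suc i)} x)" for x
    proof -
      have K_sum: "(\<Sum>i\<in>K j. \<phi> (q i) * indicator {q i..<q (Suc i)} x) =
        (\<Sum>i<m. (if i \<in> K j then \<phi> (q i) else 0) * indicator {q i..<q (Suc i)} x)"
        by (rule sum.mono_neutral_cong_left) (auto simp: K_def)
      show ?thesis
      proof (rule sum_disjoint_indicator_cases[of m q x, OF q(2)])
        assume none: "\<And>i. i < m \<Longrightarrow> x \<notin> {q i..<q (Suc i)}"
          and 0: "\<And>z :: nat \<Rightarrow> real. (\<Sum>i<m. z i * indicator {q i..<q (Suc i)} x) = 0"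
        have "x < q 0 \<or> q m \<le> x" using increasing_steps_cover[of q x m] none by force
        moreover have "q 0 \<le> s j \<and> t j \<le> q m"
          using Qq[OF inQ(1)] Qq[OF inQ(2)] increasing_steps_le[of m q] q(2) by (metis le0 order_refl)
        ultimately have "x \<notin> {s j..<t j}" by auto
        then show ?thesis unfolding K_sum 0 by simp
      next
        fix k assume k: "k < m" "x \<in> {q k..<q (Suc k)}"
          and z: "\<And>z :: nat \<Rightarrow> real. (\<Sum>i<m. z i * indicator {q i..<q (Suc i)} x) = z k"
        \<comment> \<open>No point of \<open>Q\<close> lies strictly inside a cell, so
          \<open>x\<close> compares with points of \<open>Q\<close> exactly as the left endpoint
          \<open>q k\<close> of its cell does; \<phi> and the indicators therefore agree at
          \<open>x\<close> and \<open>q k\<close>.\<close>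
        have le_iff: "y \<le> x \<longleftrightarrow> y \<le> q k" if y: "y \<in> Q" for y
        proof -
          obtain l where l: "l \<le> m" "y = q l" using Qq[OF y] by blast
          show ?thesis
          proof (cases "l \<le> k")
            case True
            then have "q l \<le> q k" using increasing_steps_le[of m q l k] q(2) k by auto
            then show ?thesis using k l by auto
          next
            case False
            then have "q (Suc k) \<le> q l" using increasing_steps_le[of m q "Suc k" l] q(2) l by auto
            moreover have "q k < q (Suc k)" using q(2) k by auto
            ultimately show ?thesis using k l by auto
          qed
        qed
        have ind_eq: "(indicator {y..<y'} x :: real) = indicator {y..<y'} (q k)" if "y \<in> Q" "y' \<in> Q" for y y'
          using le_iff[OF that(1)] le_iff[OF that(2)] by (auto simp: indicator_def not_le[symmetric])
        have "\<phi> x = \<phi> (q k)" unfolding \<phi> using inQ(3) by (intro sum.cong) (auto simp: ind_eq)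
        moreover have "indicator {s j..<t j} x = (if k \<in> K j then 1 else 0 :: real)"
          using ind_eq[OF inQ(1,2)] k by (auto simp: K_def indicator_def)
        ultimately show ?thesis unfolding K_sum z by simp
      qed
    qed
    moreover have "step_integral (\<lambda>x. \<Sum>i\<in>K j. \<phi> (q i) * indicator {q i..<q (Suc i)} x) (D j)"
      unfolding D_def[abs_def] \<Delta>_def
    proof (intro step_integral_sum scale step_integral_increment)
      fix i assume "i \<in> K j"
      then show "0 \<le> q i" "q i \<le> q (Suc i)" using q0 q(2)[of i] by (auto simp: K_def)
    qed
    ultimately show ?thesis by simp
  qed
  have normal: "distributed M lborel (D j) (normal_density 0 (sqrt v))"
    if j: "j \<in> S" and v: "v = (\<integral>x. (\<phi> x * indicator {s j..<t j} x)\<^sup>2 \<partial>lborel)" "0 < v" for j v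
  proof -
    \<comment> \<open>Cells on which \<phi> vanishes would contribute a degenerate law without
      density and are dropped; a positive variance ensures that some cell remains.\<close>
    define K' where "K' = {i \<in> K j. \<phi> (q i) \<noteq> 0}"
    define sd where "sd i = \<bar>\<phi> (q i)\<bar> * sqrt (q (Suc i) - q i)" for i
    have D': "D j = (\<lambda>\<omega>. \<Sum>i\<in>K'. \<phi> (q i) * \<Delta> i \<omega>)"
      unfolding D_def K'_def using finK by (intro ext sum.mono_neutral_right) auto
    have ED: "expectation (\<lambda>\<omega>. (D j \<omega>)\<^sup>2) = v" using step_isometry(3)[OF step[OF j]] v by simp
    have ne: "K' \<noteq> {}" using ED v(2) unfolding D' by auto
    have finK': "finite K'" using finK by (simp add: K'_def)
    have sub: "K' \<subseteq> {..<m}" by (auto simp: K'_def K_def)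
    have sd: "0 < sd i" if "i \<in> K'" for i
      using that q(2)[of i] by (auto simp: sd_def K'_def K_def)
    have "distributed M lborel (\<lambda>\<omega>. \<Sum>i\<in>K'. \<phi> (q i) * \<Delta> i \<omega>) (normal_density (\<Sum>i\<in>K'. 0) (sqrt (\<Sum>i\<in>K'. (sd i)\<^sup>2)))"
    proof (rule sum_indep_normal[OF finK' ne])
      show "indep_vars (\<lambda>_. borel) (\<lambda>i \<omega>. \<phi> (q i) * \<Delta> i \<omega>) K'"
        by (rule indep_vars_compose2[OF indep_vars_subset[OF ind\<Delta> sub]]) simp
      fix i assume i: "i \<in> K'"
      then have lt: "i < m" using sub by auto
      have "distributed M lborel (\<Delta> i) (normal_density 0 (sqrt (q (Suc i) - q i)))"
        unfolding \<Delta>_def using q0 q(2) lt by (intro increment_distributed) auto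
      from normal_density_affine[OF this, of "\<phi> (q i)" 0]
      show "distributed M lborel (\<lambda>\<omega>. \<phi> (q i) * \<Delta> i \<omega>) (normal_density 0 (sd i))"
        using i q(2)[OF lt] by (simp add: sd_def K'_def)
    qed (rule sd)
    then have dist: "distributed M lborel (D j) (normal_density 0 (sqrt (\<Sum>i\<in>K'. (sd i)\<^sup>2)))"
      unfolding D' by simp
    have pos: "0 < (\<Sum>i\<in>K'. (sd i)\<^sup>2)" using sd by (intro sum_pos finK' ne zero_less_power) auto
    have "v = (\<Sum>i\<in>K'. (sd i)\<^sup>2)"
      using normal_second_moment[OF dist] pos ED by simp
    then show ?thesis using dist by simp
  qed
  show ?thesis using that[OF indD step] normal by blast
qed

end

section \<open>Oscillation of the integral process\<close>

lemma sum_adjacent_indicators: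
  fixes h a x :: real
  assumes "0 \<le> h"
  shows "(\<Sum>k<m. indicator {a + real k * h..<a + (real k + 1) * h} x :: real) = indicator {a..<a + real m * h} x"
proof (induction m)
  case (Suc m)
  define z where "z = real m * h"
  have z: "0 \<le> z" "(real m + 1) * h = z + h" "real (Suc m) * h = z + h"
    using assms by (auto simp: z_def algebra_simps)
  show ?case
    using z(1) assms unfolding sum.lessThan_Suc Suc.IH z(2,3) z_def[symmetric] by (auto simp: indicator_def)
qed simp

text \<open>The Young inequality with weights \<open>5/4\<close> and \<open>5\<close> bounds each of the two norms by the other.\<close>

lemma L2_norm_close:
  fixes u v :: "real \<Rightarrow> real"
  assumes [measurable]: "u \<in> borel_measurable borel" "v \<in> borel_measurable borel"
    and int: "integrable lborel (\<lambda>x. (u x)\<^sup>2)" "integrable lborel (\<lambda>x. (v x)\<^sup>2)"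
    and close: "(\<integral>\<^sup>+x. ennreal ((u x - v x)\<^sup>2) \<partial>lborel) \<le> ennreal (w / 40)" and w: "0 \<le> w"
    and v: "3 / 4 * w \<le> (\<integral>x. (v x)\<^sup>2 \<partial>lborel)" "(\<integral>x. (v x)\<^sup>2 \<partial>lborel) \<le> 5 / 4 * w"
  shows "w / 2 \<le> (\<integral>x. (u x)\<^sup>2 \<partial>lborel)" "(\<integral>x. (u x)\<^sup>2 \<partial>lborel) \<le> 2 * w"
proof -
  have d: "integrable lborel (\<lambda>x. (u x - v x)\<^sup>2)"
    using int integrable_mult_of_squares[of u lborel v] by (simp add: power2_diff mult.assoc)
  define d where "d = (\<integral>x. (u x - v x)\<^sup>2 \<partial>lborel)"
  \<comment> \<open>The 40 makes \<open>5 * d\<close> at most \<open>w / 8\<close>: the lower factor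
    becomes exactly \<open>4 / 5 * (3 / 4 - 1 / 8) = 1 / 2\<close>, and the upper one is
    \<open>25 / 16 + 1 / 8 < 2\<close>.\<close>
  have d_le: "d \<le> w / 40"
    using close d w by (simp add: nn_integral_eq_integral d_def ennreal_le_iff)
  have young: "(a::real)\<^sup>2 \<le> 5 / 4 * b\<^sup>2 + 5 * (a - b)\<^sup>2" for a b
  proof -
    have "5 / 4 * b\<^sup>2 + 5 * (a - b)\<^sup>2 - a\<^sup>2 = (2 * a - 5 / 2 * b)\<^sup>2"
      by (simp add: power2_eq_square field_simps)
    then show ?thesis using zero_le_power2[of "2 * a - 5 / 2 * b"] by linarith
  qed
  have "(\<integral>x. (u x)\<^sup>2 \<partial>lborel) \<le> (\<integral>x. 5 / 4 * (v x)\<^sup>2 + 5 * (u x - v x)\<^sup>2 \<partial>lborel)"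
    using int d young by (intro integral_mono) auto
  also have "\<dots> = 5 / 4 * (\<integral>x. (v x)\<^sup>2 \<partial>lborel) + 5 * d"
    using int d by (simp add: d_def)
  finally show "(\<integral>x. (u x)\<^sup>2 \<partial>lborel) \<le> 2 * w" using v(2) d_le w by linarith
  have "(\<integral>x. (v x)\<^sup>2 \<partial>lborel) \<le> (\<integral>x. 5 / 4 * (u x)\<^sup>2 + 5 * (u x - v x)\<^sup>2 \<partial>lborel)"
    using int d young by (intro integral_mono) (auto simp: power2_commute[of "u _"])
  also have "\<dots> = 5 / 4 * (\<integral>x. (u x)\<^sup>2 \<partial>lborel) + 5 * d"
    using int d by (simp add: d_def)
  finally show "w / 2 \<le> (\<integral>x. (u x)\<^sup>2 \<partial>lborel)" using v(1) d_le w by linarith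
qed

lemma (in prob_space) chebyshev_nn_integral:
  assumes [measurable]: "U \<in> borel_measurable M" and le: "(\<integral>\<^sup>+\<omega>. ennreal ((U \<omega>)\<^sup>2) \<partial>M) \<le> ennreal m"
    and "0 \<le> m" "0 < r"
  shows "prob {\<omega> \<in> space M. r \<le> \<bar>U \<omega>\<bar>} \<le> m / r\<^sup>2"
proof -
  have "emeasure M {\<omega> \<in> space M. 1 \<le> ennreal (1 / r\<^sup>2) * ennreal ((U \<omega>)\<^sup>2)} \<le>
    ennreal (1 / r\<^sup>2) * (\<integral>\<^sup>+\<omega>. ennreal ((U \<omega>)\<^sup>2) * indicator (space M) \<omega> \<partial>M)"
    by (rule nn_integral_Markov_inequality) auto
  also have "(\<integral>\<^sup>+\<omega>. ennreal ((U \<omega>)\<^sup>2) * indicator (space M) \<omega> \<partial>M) = (\<integral>\<^sup>+\<omega>. ennreal ((U \<omega>)\<^sup>2) \<partial>M)"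
    by (intro nn_integral_cong) auto
  also have "ennreal (1 / r\<^sup>2) * (\<integral>\<^sup>+\<omega>. ennreal ((U \<omega>)\<^sup>2) \<partial>M) \<le> ennreal (1 / r\<^sup>2) * ennreal m"
    using le by (intro mult_left_mono) auto
  also have "\<dots> = ennreal (m / r\<^sup>2)" using assms by (simp add: ennreal_mult[symmetric])
  also have "{\<omega> \<in> space M. 1 \<le> ennreal (1 / r\<^sup>2) * ennreal ((U \<omega>)\<^sup>2)} = {\<omega> \<in> space M. r \<le> \<bar>U \<omega>\<bar>}"
  proof (intro Collect_cong conj_cong refl)
    fix \<omega>
    have "1 \<le> ennreal (1 / r\<^sup>2) * ennreal ((U \<omega>)\<^sup>2) \<longleftrightarrow> r\<^sup>2 \<le> (U \<omega>)\<^sup>2"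
      using assms(4) by (simp add: ennreal_mult[symmetric] le_divide_eq flip: ennreal_1)
    also have "\<dots> \<longleftrightarrow> r \<le> \<bar>U \<omega>\<bar>" using assms(4) by (simp add: abs_le_square_iff[symmetric])
    finally show "1 \<le> ennreal (1 / r\<^sup>2) * ennreal ((U \<omega>)\<^sup>2) \<longleftrightarrow> r \<le> \<bar>U \<omega>\<bar>" .
  qed
  finally show ?thesis using assms by (simp add: emeasure_eq_measure)
qed

section \<open>Step approximation of the increments of the integral process\<close>

locale wiener_integral_process = wiener M W for M :: "'a measure" and W +
  fixes f :: "real \<Rightarrow> real" and B :: "real \<Rightarrow> 'a \<Rightarrow> real"
  assumes ito: "\<And>t. t \<in> {0..1} \<Longrightarrow> is_ito_integral M W t (\<lambda>x \<omega>. f x) (B t)"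
begin

text \<open>Extended by zero, the integrand is a square integrable Borel function on the whole line;
  nothing is known about \<open>f\<close> outside the time interval.\<close>

definition g :: "real \<Rightarrow> real" where "g x = f x * indicator {0..1} x"

lemma B_measurable: "t \<in> {0..1} \<Longrightarrow> B t \<in> borel_measurable M"
  using ito by (simp add: is_ito_integral_def)

lemma g_measurable [measurable]: "g \<in> borel_measurable borel"
  using ito_deterministic_integrand_measurable[OF ito[of 1]] by (simp add: g_def[abs_def])

lemma g_square_integrable: "integrable lborel (\<lambda>x. (g x)\<^sup>2)"
proof (rule integrableI_nonneg)
  have "(\<integral>\<^sup>+x. ennreal ((g x)\<^sup>2) \<partial>lborel) = (\<integral>\<^sup>+x\<in>{0..1}. ennreal ((f x)\<^sup>2) \<partial>lborel)"
    by (intro nn_integral_cong) (auto simp: g_def indicator_def)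
  also have "\<dots> = (\<integral>\<^sup>+\<omega>. (\<integral>\<^sup>+x\<in>{0..1}. ennreal ((f x)\<^sup>2) \<partial>lborel) \<partial>M)"
    by (simp add: emeasure_space_1)
  also have "\<dots> < \<infinity>" using ito[of 1] unfolding is_ito_integral_def ito_integrable_def by auto
  finally show "(\<integral>\<^sup>+x. ennreal ((g x)\<^sup>2) \<partial>lborel) < \<infinity>" .
qed auto

lemma process_step_approx:
  assumes t: "t \<in> {0..1}" and e: "0 < (e::real)"
  obtains \<psi> Z where "step_integral \<psi> Z"
    "(\<integral>\<^sup>+x. ennreal ((g x * indicator {0..<t} x - \<psi> x)\<^sup>2) \<partial>lborel) < ennreal e"
    "(\<integral>\<^sup>+\<omega>. ennreal ((B t \<omega> - Z \<omega>)\<^sup>2) \<partial>M) < ennreal e"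
proof -
  obtain n p c where p: "p 0 = 0" "p n = t" "\<And>i. i < n \<Longrightarrow> p i < p (Suc i)"
    and 1: "(\<integral>\<^sup>+x\<in>{0..t}. ennreal ((f x - (\<Sum>i<n. c i * indicator {p i..<p (Suc i)} x))\<^sup>2) \<partial>lborel) < ennreal e"
    and 2: "(\<integral>\<^sup>+\<omega>. ennreal ((B t \<omega> - (\<Sum>i<n. c i * (W (p (Suc i)) \<omega> - W (p i) \<omega>)))\<^sup>2) \<partial>M) < ennreal e"
    by (rule ito_deterministic_approx[OF ito[OF t] _ e]) (use t in auto)
  define \<psi> where "\<psi> x = (\<Sum>i<n. c i * indicator {p i..<p (Suc i)} x)" for x
  have p_range: "0 \<le> p i" "p (Suc i) \<le> t" if "i < n" for i
    using increasing_steps_le[of n p 0 i] increasing_steps_le[of n p "Suc i" n] p that by auto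
  have supp: "\<psi> x = 0" if "x \<notin> {0..<t}" for x
    unfolding \<psi>_def using that p_range by (intro sum.neutral) (force simp: indicator_def)
  show ?thesis
  proof (rule that[of \<psi>])
    show "step_integral \<psi> (\<lambda>\<omega>. \<Sum>i<n. c i * (W (p (Suc i)) \<omega> - W (p i) \<omega>))"
      unfolding \<psi>_def[abs_def] using p_range p(3)
      by (intro step_integral_sum scale step_integral_increment) (auto simp: less_imp_le)
    have "(\<integral>\<^sup>+x. ennreal ((g x * indicator {0..<t} x - \<psi> x)\<^sup>2) \<partial>lborel) \<le>
      (\<integral>\<^sup>+x\<in>{0..t}. ennreal ((f x - \<psi> x)\<^sup>2) \<partial>lborel)"
      using t supp by (intro nn_integral_mono) (auto simp: g_def indicator_def)
    then show "(\<integral>\<^sup>+x. ennreal ((g x * indicator {0..<t} x - \<psi> x)\<^sup>2) \<partial>lborel) < ennreal e"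
      using 1 unfolding \<psi>_def by (rule le_less_trans)
  qed (rule 2)
qed

text \<open>\<open>B s\<close> and \<open>B t\<close> come with step integrals along unrelated
  partitions; the isometry compares their difference with \<open>X\<close> on the side of the
  integrands. Repeated use of \<open>(u + v)\<^sup>2 \<le> 2 * u\<^sup>2 + 2 * v\<^sup>2\<close>
  gives \<open>4 * e\<close> for the two approximations of \<open>B\<close>, \<open>16 * e\<close>
  for the comparison, and twice their sum in all.\<close>

lemma increment_step_approx:
  assumes st: "0 \<le> s" "s \<le> t" "t \<le> 1" and e: "0 < (e::real)"
    and \<phi>: "\<phi> \<in> borel_measurable borel"
      "(\<integral>\<^sup>+x\<in>{0..<1}. ennreal ((\<phi> x - g x)\<^sup>2) \<partial>lborel) \<le> ennreal e"
    and X: "step_integral (\<lambda>x. \<phi> x * indicator {s..<t} x) X"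
  shows "(\<integral>\<^sup>+\<omega>. ennreal ((B t \<omega> - B s \<omega> - X \<omega>)\<^sup>2) \<partial>M) \<le> ennreal (40 * e)"
proof -
  note [measurable] = \<phi>(1)
  have [measurable]: "B t \<in> borel_measurable M" "B s \<in> borel_measurable M" using B_measurable st by auto
  obtain \<psi> Z where Z: "step_integral \<psi> Z"
    "(\<integral>\<^sup>+x. ennreal ((g x * indicator {0..<t} x - \<psi> x)\<^sup>2) \<partial>lborel) < ennreal e"
    "(\<integral>\<^sup>+\<omega>. ennreal ((B t \<omega> - Z \<omega>)\<^sup>2) \<partial>M) < ennreal e"
    by (rule process_step_approx[of t e]) (use st e in auto)
  obtain \<psi>' Z' where Z': "step_integral \<psi>' Z'"
    "(\<integral>\<^sup>+x. ennreal ((g x * indicator {0..<s} x - \<psi>' x)\<^sup>2) \<partial>lborel) < ennreal e"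
    "(\<integral>\<^sup>+\<omega>. ennreal ((B s \<omega> - Z' \<omega>)\<^sup>2) \<partial>M) < ennreal e"
    by (rule process_step_approx[of s e]) (use st e in auto)
  note [measurable] = step_integral_measurable[OF Z(1)] step_integral_measurable[OF Z'(1)] step_integral_measurable(2)[OF X]
  have half: "(\<integral>\<^sup>+x. ennreal ((\<phi> x * indicator {0..<r} x - \<theta> x)\<^sup>2) \<partial>lborel) \<le> 4 * ennreal e"
    if r: "r \<le> 1" and \<theta>[measurable]: "\<theta> \<in> borel_measurable borel"
      and le: "(\<integral>\<^sup>+x. ennreal ((g x * indicator {0..<r} x - \<theta> x)\<^sup>2) \<partial>lborel) < ennreal e" for r \<theta>
  proof -
    have "(\<integral>\<^sup>+x. ennreal ((\<phi> x * indicator {0..<r} x - \<theta> x)\<^sup>2) \<partial>lborel) =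
      (\<integral>\<^sup>+x. ennreal (((\<phi> x - g x) * indicator {0..<r} x + (g x * indicator {0..<r} x - \<theta> x))\<^sup>2) \<partial>lborel)"
      by (simp add: left_diff_distrib)
    also have "\<dots> \<le> 2 * (\<integral>\<^sup>+x. ennreal (((\<phi> x - g x) * indicator {0..<r} x)\<^sup>2) \<partial>lborel) +
        2 * (\<integral>\<^sup>+x. ennreal ((g x * indicator {0..<r} x - \<theta> x)\<^sup>2) \<partial>lborel)"
      by (rule nn_integral_square_add_le) measurable
    also have "\<dots> \<le> 2 * ennreal e + 2 * ennreal e"
    proof (intro add_mono mult_left_mono)
      have "(\<integral>\<^sup>+x. ennreal (((\<phi> x - g x) * indicator {0..<r} x)\<^sup>2) \<partial>lborel) \<le> (\<integral>\<^sup>+x\<in>{0..<1}. ennreal ((\<phi> x - g x)\<^sup>2) \<partial>lborel)"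
        using r by (intro nn_integral_mono) (auto simp: indicator_def)
      then show "(\<integral>\<^sup>+x. ennreal (((\<phi> x - g x) * indicator {0..<r} x)\<^sup>2) \<partial>lborel) \<le> ennreal e"
        using \<phi>(2) by (rule order_trans)
    qed (use le in auto)
    finally show ?thesis by (simp add: distrib_right[symmetric])
  qed
  have "step_integral (\<lambda>x. (\<psi> x - \<psi>' x) - \<phi> x * indicator {s..<t} x) (\<lambda>\<omega>. (Z \<omega> - Z' \<omega>) - X \<omega>)"
    by (intro step_integral_diff Z Z' X)
  from step_isometry(4)[OF this]
  have "(\<integral>\<^sup>+\<omega>. ennreal (((Z \<omega> - Z' \<omega>) - X \<omega>)\<^sup>2) \<partial>M) =
    (\<integral>\<^sup>+x. ennreal (((\<psi> x - \<psi>' x) - \<phi> x * indicator {s..<t} x)\<^sup>2) \<partial>lborel)" .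
  \<comment> \<open>The indicator of \<open>{s..<t}\<close> is split so that each endpoint is
    matched with its own step function.\<close>
  also have "\<dots> = (\<integral>\<^sup>+x. ennreal (((\<phi> x * indicator {0..<s} x - \<psi>' x) + (- (\<phi> x * indicator {0..<t} x - \<psi> x)))\<^sup>2) \<partial>lborel)"
    using st by (intro nn_integral_cong arg_cong[where f=ennreal] arg_cong[where f="\<lambda>x. x\<^sup>2"]) (auto simp: indicator_def)
  also have "\<dots> \<le> 2 * (\<integral>\<^sup>+x. ennreal ((\<phi> x * indicator {0..<s} x - \<psi>' x)\<^sup>2) \<partial>lborel) +
      2 * (\<integral>\<^sup>+x. ennreal ((- (\<phi> x * indicator {0..<t} x - \<psi> x))\<^sup>2) \<partial>lborel)"
    by (rule nn_integral_square_add_le) measurable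
  also have "\<dots> \<le> 2 * (4 * ennreal e) + 2 * (4 * ennreal e)"
    unfolding power2_minus using st Z(2) Z'(2) by (intro add_mono mult_left_mono half) auto
  finally have ZX: "(\<integral>\<^sup>+\<omega>. ennreal (((Z \<omega> - Z' \<omega>) - X \<omega>)\<^sup>2) \<partial>M) \<le> 16 * ennreal e"
    by (simp add: mult.assoc[symmetric] distrib_right[symmetric])
  have "(\<integral>\<^sup>+\<omega>. ennreal (((B t \<omega> - Z \<omega>) + (- (B s \<omega> - Z' \<omega>)))\<^sup>2) \<partial>M) \<le>
      2 * (\<integral>\<^sup>+\<omega>. ennreal ((B t \<omega> - Z \<omega>)\<^sup>2) \<partial>M) + 2 * (\<integral>\<^sup>+\<omega>. ennreal ((- (B s \<omega> - Z' \<omega>))\<^sup>2) \<partial>M)"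
    by (rule nn_integral_square_add_le) measurable
  also have "\<dots> \<le> 2 * ennreal e + 2 * ennreal e"
    unfolding power2_minus using Z(3) Z'(3) by (intro add_mono mult_left_mono) auto
  finally have BZ: "(\<integral>\<^sup>+\<omega>. ennreal (((B t \<omega> - Z \<omega>) + (- (B s \<omega> - Z' \<omega>)))\<^sup>2) \<partial>M) \<le> 4 * ennreal e"
    by (simp add: distrib_right[symmetric])
  have "(\<integral>\<^sup>+\<omega>. ennreal ((B t \<omega> - B s \<omega> - X \<omega>)\<^sup>2) \<partial>M) =
    (\<integral>\<^sup>+\<omega>. ennreal ((((B t \<omega> - Z \<omega>) + (- (B s \<omega> - Z' \<omega>))) + ((Z \<omega> - Z' \<omega>) - X \<omega>))\<^sup>2) \<partial>M)"
    by (simp add: algebra_simps)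
  also have "\<dots> \<le> 2 * (\<integral>\<^sup>+\<omega>. ennreal (((B t \<omega> - Z \<omega>) + (- (B s \<omega> - Z' \<omega>)))\<^sup>2) \<partial>M) +
      2 * (\<integral>\<^sup>+\<omega>. ennreal (((Z \<omega> - Z' \<omega>) - X \<omega>)\<^sup>2) \<partial>M)"
    by (rule nn_integral_square_add_le) measurable
  also have "\<dots> \<le> 2 * (4 * ennreal e) + 2 * (16 * ennreal e)"
    using BZ ZX by (intro add_mono mult_left_mono) auto
  also have "\<dots> = 40 * ennreal e" by (simp add: mult.assoc[symmetric] distrib_right[symmetric])
  also have "\<dots> = ennreal (40 * e)" using e by (simp add: ennreal_mult)
  finally show ?thesis .
qed

end

text \<open>The bound of \<open>normal_interval_lower_bound\<close> at \<open>x = 3 ^ i\<close>: the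
  chance that increment \<open>i\<close> falls into its box, the same for all attempts.\<close>

definition box_prob :: "nat \<Rightarrow> real" where
  "box_prob i = 3 ^ i / (4 * sqrt pi) * exp (- 9 / 4 * (3 ^ i)\<^sup>2)"

lemma box_prob_pos: "0 < box_prob i"
  by (simp add: box_prob_def)

context wiener_integral_process
begin

text \<open>If attempt \<open>l\<close> succeeds for the step integrals, its signed partial sums
  reach \<open>\<sigma> l\<close>, at least \<open>2 * R l\<close>. The same attempt can then fail
  for \<open>B\<close> only if some approximation error reaches \<open>R l\<close>, which
  Chebyshev's inequality makes improbable.\<close>

lemma oscillation_attempts_fail:
  fixes K N :: nat and a R \<sigma> :: "nat \<Rightarrow> real"
  assumes N: "0 < N" and R: "\<And>l. 0 < R l" and a: "\<And>l. 0 \<le> a l" "\<And>l. a l + R l \<le> 1"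
    and \<sigma>: "\<And>l. 0 < \<sigma> l" "\<And>l. 2 * R l \<le> \<sigma> l"
    and cols: "\<And>l i. i < N \<Longrightarrow>
      3 / 4 * (\<sigma> l)\<^sup>2 \<le> (\<integral>x. (g x)\<^sup>2 * indicator {a l + real i * (R l / N)..<a l + (real i + 1) * (R l / N)} x \<partial>lborel) \<and>
      (\<integral>x. (g x)\<^sup>2 * indicator {a l + real i * (R l / N)..<a l + (real i + 1) * (R l / N)} x \<partial>lborel) \<le> 5 / 4 * (\<sigma> l)\<^sup>2"
    and disj: "disjoint_family_on (\<lambda>(l, i). {a l + real i * (R l / N)..<a l + (real i + 1) * (R l / N)}) ({..<K} \<times> {..<N})"
  shows "prob {\<omega> \<in> space M. \<forall>l<K. \<exists>i<N. (-1) ^ i * (B (a l + (real i + 1) * (R l / N)) \<omega> - B (a l) \<omega>) < R l}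
    \<le> (1 - (\<Prod>i<N. box_prob i)) ^ K"
proof (rule field_le_epsilon)
  fix \<epsilon> :: real assume \<epsilon>: "0 < \<epsilon>"
  define h where "h l = R l / N" for l
  have h: "0 < h l" "real N * h l = R l" for l using R[of l] N by (auto simp: h_def)
  define S where "S = {..<K} \<times> {..<N}"
  have finS: "finite S" by (simp add: S_def)
  define C where "C = (\<Sum>j\<in>S. 40 / (R (fst j))\<^sup>2)"
  have C: "0 \<le> C" unfolding C_def by (intro sum_nonneg) auto
  \<comment> \<open>The first bound makes the sum \<open>C * e\<close> of all Chebyshev bounds at
    most \<epsilon>; the others keep the variances of the approximating increments within a factor 2
    of \<open>(\<sigma> l)\<^sup>2\<close>.\<close>
  define e where "e = Min (insert (\<epsilon> / (C + 1)) ((\<lambda>l. (\<sigma> l)\<^sup>2 / 40) ` {..<K}))"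
  have e: "0 < e" unfolding e_def using \<epsilon> C \<sigma>(1) by (subst Min_gr_iff) (auto simp: less_imp_neq[symmetric] add_nonneg_pos)
  have e1: "e \<le> \<epsilon> / (C + 1)" unfolding e_def by (intro Min_le) auto
  have e2: "e \<le> (\<sigma> l)\<^sup>2 / 40" if "l < K" for l unfolding e_def using that by (intro Min_le) auto
  have "C * e \<le> (C + 1) * (\<epsilon> / (C + 1))" using e1 e C by (intro mult_mono) auto
  then have Ce: "C * e \<le> \<epsilon>" using C by (simp add: add_nonneg_eq_0_iff)
  obtain n p c where p: "p 0 = 0" "p n = 1" "\<And>i. i < n \<Longrightarrow> p i < p (Suc i)"
    and ap: "(\<integral>\<^sup>+x\<in>{0..1}. ennreal ((f x - (\<Sum>i<n. c i * indicator {p i..<p (Suc i)} x))\<^sup>2) \<partial>lborel) < ennreal e"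
    by (rule ito_deterministic_approx[OF ito[of 1] _ e]) auto
  define \<phi> where "\<phi> = (\<lambda>x. \<Sum>i<n. c i * indicator {p i..<p (Suc i)} x :: real)"
  have [measurable]: "\<phi> \<in> borel_measurable borel" unfolding \<phi>_def by measurable
  have "(\<integral>\<^sup>+x\<in>{0..<1}. ennreal ((\<phi> x - g x)\<^sup>2) \<partial>lborel) \<le> (\<integral>\<^sup>+x\<in>{0..1}. ennreal ((f x - \<phi> x)\<^sup>2) \<partial>lborel)"
    by (intro nn_integral_mono) (auto simp: indicator_def g_def power2_commute)
  also have "\<dots> \<le> ennreal e" using ap by (simp add: \<phi>_def)
  finally have \<phi>: "(\<integral>\<^sup>+x\<in>{0..<1}. ennreal ((\<phi> x - g x)\<^sup>2) \<partial>lborel) \<le> ennreal e" .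
  define s t where "s = (\<lambda>(l, i). a l + real i * h l)" and "t = (\<lambda>(l, i). a l + (real i + 1) * h l)"
  have col_range: "a l \<le> s (l, i)" "s (l, i) \<le> t (l, i)" "a l \<le> t (l, i)" "t (l, i) \<le> 1" if "i < N" for l i
  proof -
    have "(real i + 1) * h l \<le> R l" unfolding h(2)[symmetric] using that h(1)[of l] by (intro mult_right_mono) auto
    moreover have "0 \<le> real i * h l" "(real i + 1) * h l = real i * h l + h l"
      using h(1)[of l] by (auto simp: algebra_simps)
    ultimately show "a l \<le> s (l, i)" "s (l, i) \<le> t (l, i)" "a l \<le> t (l, i)" "t (l, i) \<le> 1"
      using a(2)[of l] h(1)[of l] by (auto simp: s_def t_def)
  qed
  have st0: "0 \<le> s j" "s j \<le> t j" "0 \<le> t j" "t j \<le> 1" if "j \<in> S" for j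
    using that col_range[of "snd j" "fst j"] a(1)[of "fst j"] by (auto simp: S_def)
  have disj': "disjoint_family_on (\<lambda>j. {s j..<t j}) S"
    using disj by (simp add: S_def s_def t_def h_def split_beta')
  obtain D where indep: "indep_vars (\<lambda>_. borel) D S"
    and step: "\<And>j. j \<in> S \<Longrightarrow> step_integral (\<lambda>x. \<phi> x * indicator {s j..<t j} x) (D j)"
    and normal: "\<And>j. j \<in> S \<Longrightarrow> 0 < (\<integral>x. (\<phi> x * indicator {s j..<t j} x)\<^sup>2 \<partial>lborel) \<Longrightarrow>
      distributed M lborel (D j) (normal_density 0 (sqrt (\<integral>x. (\<phi> x * indicator {s j..<t j} x)\<^sup>2 \<partial>lborel)))"
  proof (rule step_integrals_indep_normal[OF finS st0(1) st0(3) disj' _ \<phi>_def])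
    show "0 \<le> p i" if "i \<le> n" for i using increasing_steps_le[of n p 0 i] p that by auto
  qed auto
  have D_meas[measurable]: "D j \<in> borel_measurable M" if "j \<in> S" for j
    using step_integral_measurable(2)[OF step[OF that]] .
  \<comment> \<open>With the sign inside the set, the event is an interval event for
    \<open>(-1) ^ i * D (l, i)\<close>, which has the same centred normal law as
    \<open>D (l, i)\<close>.\<close>
  define A where "A l i = {y :: real. 3 ^ i * \<sigma> l \<le> (-1) ^ i * y \<and> (-1) ^ i * y \<le> 3 / 2 * (3 ^ i * \<sigma> l)}" for l i
  have A_meas[measurable]: "A l i \<in> sets borel" for l i unfolding A_def by measurable
  have box: "box_prob i \<le> prob {\<omega> \<in> space M. D (l, i) \<omega> \<in> A l i}" if li: "l < K" "i < N" for l i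
  proof -
    have j: "(l, i) \<in> S" using li by (simp add: S_def)
    define I where "I = {s (l, i)..<t (l, i)}"
    define v where "v = (\<integral>x. (\<phi> x * indicator I x)\<^sup>2 \<partial>lborel)"
    have gsq: "(g x * indicator I x)\<^sup>2 = (g x)\<^sup>2 * indicator I x" for x by (auto simp: indicator_def)
    have int: "integrable lborel (\<lambda>x. (\<phi> x * indicator I x)\<^sup>2)" "integrable lborel (\<lambda>x. (g x * indicator I x)\<^sup>2)"
      using step_isometry(2)[OF step[OF j]] g_square_integrable unfolding gsq
      by (auto simp: I_def intro!: integrable_real_mult_indicator)
    have "(\<integral>\<^sup>+x. ennreal ((\<phi> x * indicator I x - g x * indicator I x)\<^sup>2) \<partial>lborel) \<le>
      (\<integral>\<^sup>+x\<in>{0..<1}. ennreal ((\<phi> x - g x)\<^sup>2) \<partial>lborel)"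
      using st0[OF j] by (intro nn_integral_mono) (auto simp: indicator_def I_def)
    also have "\<dots> \<le> ennreal ((\<sigma> l)\<^sup>2 / 40)"
      by (rule order_trans[OF \<phi> ennreal_leI[OF e2[OF li(1)]]])
    finally have close: "(\<integral>\<^sup>+x. ennreal ((\<phi> x * indicator I x - g x * indicator I x)\<^sup>2) \<partial>lborel) \<le> ennreal ((\<sigma> l)\<^sup>2 / 40)" .
    have "3 / 4 * (\<sigma> l)\<^sup>2 \<le> (\<integral>x. (g x * indicator I x)\<^sup>2 \<partial>lborel)"
      "(\<integral>x. (g x * indicator I x)\<^sup>2 \<partial>lborel) \<le> 5 / 4 * (\<sigma> l)\<^sup>2"
      unfolding gsq using cols[OF li(2), of l] by (auto simp: I_def s_def t_def h_def)
    from L2_norm_close[OF _ _ int close _ this]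
    have v: "(\<sigma> l)\<^sup>2 / 2 \<le> v" "v \<le> 2 * (\<sigma> l)\<^sup>2" by (auto simp: v_def I_def)
    have v0: "0 < v" using v(1) \<sigma>(1)[of l] by (smt (verit) half_gt_zero zero_less_power)
    have "distributed M lborel (D (l, i)) (normal_density 0 (sqrt v))"
      using normal[OF j] v0 by (simp add: v_def I_def)
    from normal_density_affine[OF this, of "(-1) ^ i" 0]
    have "distributed M lborel (\<lambda>\<omega>. (-1) ^ i * D (l, i) \<omega>) (normal_density 0 (sqrt v))"
      using v0 by (simp add: power_abs[symmetric])
    from normal_interval_lower_bound[OF this, of "\<sigma> l" "3 ^ i"] show ?thesis
      using v0 v \<sigma>(1)[of l] by (simp add: box_prob_def A_def)
  qed
  define Fail where "Fail = {\<omega> \<in> space M. \<forall>l<K. \<exists>i<N. D (l, i) \<omega> \<notin> A l i}"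
  have Fail: "prob Fail \<le> (1 - (\<Prod>i<N. box_prob i)) ^ K"
    unfolding Fail_def
    by (rule indep_attempts_all_fail[OF indep[unfolded S_def] N A_meas _ box]) (simp add: box_prob_pos less_imp_le)
  \<comment> \<open>Errors are taken for the sums from the start of the attempt. Their integrands
    combine to \<phi> on the single interval \<open>{a l..<t (l, i)}\<close>, so the column errors
    do not accumulate.\<close>
  define U where "U = (\<lambda>(l, i) \<omega>. B (t (l, i)) \<omega> - B (a l) \<omega> - (\<Sum>k<Suc i. D (l, k) \<omega>))"
  have Bm: "B (t (l, i)) \<in> borel_measurable M" "B (a l) \<in> borel_measurable M" if "i < N" for l i
    using col_range[OF that, of l] a(1)[of l] by (auto intro!: B_measurable)
  have U_meas: "U j \<in> borel_measurable M" if j: "j \<in> S" for j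
  proof -
    obtain l i where li: "j = (l, i)" "l < K" "i < N" using j by (auto simp: S_def)
    have "D (l, k) \<in> borel_measurable M" if "k \<in> {..<Suc i}" for k
      using that li by (intro D_meas) (auto simp: S_def)
    then show ?thesis unfolding U_def li prod.case using Bm[OF li(3), of l]
      by (intro borel_measurable_diff borel_measurable_sum) auto
  qed
  have err: "prob {\<omega> \<in> space M. R (fst j) \<le> \<bar>U j \<omega>\<bar>} \<le> 40 * e / (R (fst j))\<^sup>2" if j: "j \<in> S" for j
  proof (rule chebyshev_nn_integral[OF U_meas[OF j]])
    obtain l i where li: "j = (l, i)" "l < K" "i < N" using j by (auto simp: S_def)
    have "step_integral (\<lambda>x. \<Sum>k<Suc i. \<phi> x * indicator {s (l, k)..<t (l, k)} x) (\<lambda>\<omega>. \<Sum>k<Suc i. D (l, k) \<omega>)"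
      using li by (intro step_integral_sum step) (auto simp: S_def)
    moreover have "(\<Sum>k<Suc i. \<phi> x * indicator {s (l, k)..<t (l, k)} x) = \<phi> x * indicator {a l..<t (l, i)} x" for x
    proof -
      have "(\<Sum>k<Suc i. indicator {s (l, k)..<t (l, k)} x :: real) = indicator {a l..<t (l, i)} x"
        using sum_adjacent_indicators[of "h l" "a l" x "Suc i"] h(1)[of l]
        by (simp only: s_def t_def prod.case) (simp add: add.commute)
      then show ?thesis by (simp only: sum_distrib_left[symmetric])
    qed
    ultimately have "step_integral (\<lambda>x. \<phi> x * indicator {a l..<t (l, i)} x) (\<lambda>\<omega>. \<Sum>k<Suc i. D (l, k) \<omega>)" by simp
    then show "(\<integral>\<^sup>+\<omega>. ennreal ((U j \<omega>)\<^sup>2) \<partial>M) \<le> ennreal (40 * e)"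
      unfolding U_def li prod.case using col_range[OF li(3), of l] a(1)[of l]
      by (intro increment_step_approx[OF _ _ _ e _ \<phi>]) auto
  qed (use e R in auto)
  define Bad where "Bad = {\<omega> \<in> space M. \<forall>l<K. \<exists>i<N. (-1) ^ i * (B (a l + (real i + 1) * (R l / N)) \<omega> - B (a l) \<omega>) < R l}"
  have "Bad \<subseteq> Fail \<union> (\<Union>j\<in>S. {\<omega> \<in> space M. R (fst j) \<le> \<bar>U j \<omega>\<bar>})"
  proof
    fix \<omega> assume \<omega>: "\<omega> \<in> Bad"
    show "\<omega> \<in> Fail \<union> (\<Union>j\<in>S. {\<omega> \<in> space M. R (fst j) \<le> \<bar>U j \<omega>\<bar>})"
    proof (cases "\<omega> \<in> Fail")
      case False
      then obtain l where l: "l < K" "\<And>i. i < N \<Longrightarrow> D (l, i) \<omega> \<in> A l i" using \<omega> by (auto simp: Fail_def Bad_def)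
      obtain i where i: "i < N" "(-1) ^ i * (B (t (l, i)) \<omega> - B (a l) \<omega>) < R l"
        using \<omega> l(1) by (auto simp: Bad_def t_def h_def)
      have "\<sigma> l \<le> (-1) ^ i * (\<Sum>k<Suc i. D (l, k) \<omega>)"
        using l(2) \<sigma>(1)[of l] i(1) by (intro alternating_partial_sums[of _ N]) (auto simp: A_def less_imp_le)
      then have "(-1) ^ i * U (l, i) \<omega> \<le> - R l"
        using i(2) \<sigma>(2)[of l] by (simp add: U_def right_diff_distrib)
      then have "R l \<le> \<bar>(-1) ^ i * U (l, i) \<omega>\<bar>" by linarith
      then have "R l \<le> \<bar>U (l, i) \<omega>\<bar>" by (simp add: abs_mult)
      then show ?thesis using l(1) i(1) \<omega> by (auto simp: S_def Bad_def intro!: bexI[of _ "(l, i)"])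
    qed simp
  qed
  moreover have Em: "{\<omega> \<in> space M. R (fst j) \<le> \<bar>U j \<omega>\<bar>} \<in> events" if "j \<in> S" for j
  proof -
    have [measurable]: "U j \<in> borel_measurable M" by (rule U_meas[OF that])
    show ?thesis by measurable
  qed
  moreover have Fm: "Fail \<in> events"
  proof -
    have "{\<omega> \<in> space M. D (l, i) \<omega> \<notin> A l i} \<in> events" if "l \<in> {..<K}" "i \<in> {..<N}" for l i
    proof -
      have [measurable]: "D (l, i) \<in> borel_measurable M" using that by (intro D_meas) (auto simp: S_def)
      show ?thesis by measurable
    qed
    then have "{\<omega> \<in> space M. \<forall>l\<in>{..<K}. \<exists>i\<in>{..<N}. D (l, i) \<omega> \<notin> A l i} \<in> events"
      by (intro sets.sets_Collect_finite_All sets.sets_Collect_finite_Ex) auto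
    then show ?thesis by (simp only: Fail_def Ball_def Bex_def lessThan_iff)
  qed
  ultimately have "prob Bad \<le> prob (Fail \<union> (\<Union>j\<in>S. {\<omega> \<in> space M. R (fst j) \<le> \<bar>U j \<omega>\<bar>}))"
    using finS by (intro finite_measure_mono) auto
  also have "\<dots> \<le> prob Fail + prob (\<Union>j\<in>S. {\<omega> \<in> space M. R (fst j) \<le> \<bar>U j \<omega>\<bar>})"
    using Em Fm finS by (intro measure_Un_le) auto
  finally have "prob Bad \<le> prob Fail + prob (\<Union>j\<in>S. {\<omega> \<in> space M. R (fst j) \<le> \<bar>U j \<omega>\<bar>})" .
  moreover have "prob (\<Union>j\<in>S. {\<omega> \<in> space M. R (fst j) \<le> \<bar>U j \<omega>\<bar>}) \<le> C * e"
  proof -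
    have "prob (\<Union>j\<in>S. {\<omega> \<in> space M. R (fst j) \<le> \<bar>U j \<omega>\<bar>}) \<le> (\<Sum>j\<in>S. prob {\<omega> \<in> space M. R (fst j) \<le> \<bar>U j \<omega>\<bar>})"
      using Em finS by (intro finite_measure_subadditive_finite) auto
    also have "\<dots> \<le> (\<Sum>j\<in>S. 40 * e / (R (fst j))\<^sup>2)" using err by (intro sum_mono) auto
    also have "\<dots> = C * e" by (simp add: C_def sum_distrib_right)
    finally show ?thesis .
  qed
  ultimately show "prob {\<omega> \<in> space M. \<forall>l<K. \<exists>i<N. (-1) ^ i * (B (a l + (real i + 1) * (R l / N)) \<omega> - B (a l) \<omega>) < R l}
    \<le> (1 - (\<Prod>i<N. box_prob i)) ^ K + \<epsilon>"
    using Fail Ce unfolding Bad_def by linarith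
qed

lemma AE_oscillation:
  assumes N: "0 < N" and zeros: "finite {x. f x = 0}"
  shows "AE \<omega> in M. \<exists>a R. 0 < R \<and> 0 \<le> a \<and> a + R \<le> 1 \<and>
    (\<forall>i<N. (-1) ^ i * (B (a + (real i + 1) * (R / real N)) \<omega> - B a \<omega>) \<ge> R)"
proof -
  \<comment> \<open>Attempt \<open>l\<close> is placed between consecutive reciprocals. This makes
    the attempts disjoint and keeps them in the unit interval, where \<open>g\<close> agrees with
    \<open>f\<close> and so has finitely many zeros.\<close>
  define good where "good l a R \<sigma> \<longleftrightarrow> 1 / real (l + 2) < a \<and> a + R < 1 / real (l + 1) \<and> 0 < R \<and> 0 < \<sigma> \<and> 2 * R \<le> \<sigma> \<and>
    (\<forall>i<N. 3 / 4 * \<sigma>\<^sup>2 \<le> (\<integral>x. (g x)\<^sup>2 * indicator {a + real i * (R / N)..<a + (real i + 1) * (R / N)} x \<partial>lborel) \<and>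
           (\<integral>x. (g x)\<^sup>2 * indicator {a + real i * (R / N)..<a + (real i + 1) * (R / N)} x \<partial>lborel) \<le> 5 / 4 * \<sigma>\<^sup>2)"
    for l :: nat and a R \<sigma> :: real
  have "\<exists>a R \<sigma>. good l a R \<sigma>" for l
    unfolding good_def
  proof (rule lebesgue_point_columns[OF g_square_integrable])
    have "{x \<in> {1 / real (l + 2)<..<1 / real (l + 1)}. (g x)\<^sup>2 = 0} \<subseteq> {x. f x = 0}"
    proof
      fix x assume "x \<in> {x \<in> {1 / real (l + 2)<..<1 / real (l + 1)}. (g x)\<^sup>2 = 0}"
      then have x: "1 / real (l + 2) < x" "x < 1 / real (l + 1)" "g x = 0" by auto
      have "0 < 1 / real (l + 2)" "1 / real (l + 1) \<le> 1" by auto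
      then have "x \<in> {0..1}" using x unfolding atLeastAtMost_iff by linarith
      then show "x \<in> {x. f x = 0}" using x by (simp add: g_def)
    qed
    then show "finite {x \<in> {1 / real (l + 2)<..<1 / real (l + 1)}. (g x)\<^sup>2 = 0}"
      using zeros by (rule finite_subset)
    show "1 / real (l + 2) < 1 / real (l + 1)" by (simp add: field_simps)
  qed (use N in auto)
  then obtain a R \<sigma> where good: "\<And>l. good l (a l) (R l) (\<sigma> l)" by metis
  have aR: "1 / real (l + 2) < a l" "a l + R l < 1 / real (l + 1)" and R: "0 < R l"
    and \<sigma>: "0 < \<sigma> l" "2 * R l \<le> \<sigma> l" for l
    using good[of l] unfolding good_def by auto
  have cols: "3 / 4 * (\<sigma> l)\<^sup>2 \<le> (\<integral>x. (g x)\<^sup>2 * indicator {a l + real i * (R l / N)..<a l + (real i + 1) * (R l / N)} x \<partial>lborel) \<and>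
      (\<integral>x. (g x)\<^sup>2 * indicator {a l + real i * (R l / N)..<a l + (real i + 1) * (R l / N)} x \<partial>lborel) \<le> 5 / 4 * (\<sigma> l)\<^sup>2"
    if "i < N" for l i
    using good[of l] that unfolding good_def by blast
  have a0: "0 \<le> a l" for l
  proof -
    have "0 < 1 / real (l + 2)" by simp
    then show ?thesis using aR(1)[of l] by linarith
  qed
  have a1: "a l + R l \<le> 1" for l
  proof -
    have "1 / real (l + 1) \<le> 1" by simp
    then show ?thesis using aR(2)[of l] by linarith
  qed
  have hN: "0 < R l / N" for l using R N by simp
  have col_sub: "{a l + real i * (R l / N)..<a l + (real i + 1) * (R l / N)} \<subseteq> {1 / real (l + 2)..<1 / real (l + 1)}"
    if "i < N" for l i
  proof -
    have "(real i + 1) * (R l / N) \<le> real N * (R l / N)" using that hN[of l] by (intro mult_right_mono) auto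
    then have "(real i + 1) * (R l / N) \<le> R l" using N by simp
    moreover have "0 \<le> real i * (R l / N)" using hN[of l] by (intro mult_nonneg_nonneg) auto
    ultimately show ?thesis using aR[of l] by auto
  qed
  have disj1: "{1 / real (l + 2)..<1 / real (l + 1)} \<inter> {1 / real (k + 2)..<1 / real (k + 1)} = {}" if "l < k" for l k
  proof -
    have "1 / real (k + 1) \<le> 1 / real (l + 2)" using that by (intro divide_left_mono) auto
    then show ?thesis by auto
  qed
  have disj2: "{b + real i * h..<b + (real i + 1) * h} \<inter> {b + real k * h..<b + (real k + 1) * h} = {}"
    if "i < k" "0 < h" for i k :: nat and b h :: real
  proof -
    have "(real i + 1) * h \<le> real k * h" using that by (intro mult_right_mono) auto
    then show ?thesis by auto
  qed
  have disj: "disjoint_family_on (\<lambda>(l, i). {a l + real i * (R l / N)..<a l + (real i + 1) * (R l / N)}) ({..<K} \<times> {..<N})" for K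
    unfolding disjoint_family_on_def
  proof (intro ballI impI)
    fix x y assume x: "x \<in> {..<K} \<times> {..<N}" and y: "y \<in> {..<K} \<times> {..<N}" and ne: "x \<noteq> y"
    obtain l i k j where xy: "x = (l, i)" "y = (k, j)" "i < N" "j < N" using x y by auto
    consider "l < k" | "k < l" | "l = k" "i < j" | "l = k" "j < i" using ne xy by fastforce
    then show "(case x of (l, i) \<Rightarrow> {a l + real i * (R l / N)..<a l + (real i + 1) * (R l / N)}) \<inter>
      (case y of (l, i) \<Rightarrow> {a l + real i * (R l / N)..<a l + (real i + 1) * (R l / N)}) = {}"
    proof cases
      case 1 then show ?thesis using disj1[of l k] col_sub[OF xy(3), of l] col_sub[OF xy(4), of k] unfolding xy prod.case by blast
    next
      case 2 then show ?thesis using disj1[of k l] col_sub[OF xy(3), of l] col_sub[OF xy(4), of k] unfolding xy prod.case by blast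
    next
      case 3 then show ?thesis using disj2[of i j "R l / N" "a l"] hN[of l] unfolding xy prod.case by simp
    next
      case 4 then show ?thesis using disj2[of j i "R l / N" "a l"] hN[of l] unfolding xy prod.case by (simp add: Int_commute)
    qed
  qed
  define Bad where "Bad K = {\<omega> \<in> space M. \<forall>l<K. \<exists>i<N. (-1) ^ i * (B (a l + (real i + 1) * (R l / N)) \<omega> - B (a l) \<omega>) < R l}" for K :: nat
  define q where "q = 1 - (\<Prod>i<N. box_prob i)"
  have Bad: "prob (Bad K) \<le> q ^ K" for K
    unfolding Bad_def q_def by (rule oscillation_attempts_fail[OF N R a0 a1 \<sigma> cols disj])
  have "q < 1" unfolding q_def using box_prob_pos by (simp add: prod_pos)
  \<comment> \<open>For \<open>K = 1\<close> the bound puts a probability below \<open>q\<close>,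
    which spares an upper estimate of the box probabilities.\<close>
  moreover have "0 \<le> q" using order_trans[OF measure_nonneg Bad[of 1]] by simp
  ultimately have lim: "(\<lambda>K. q ^ K) \<longlonglongrightarrow> 0" by (rule LIMSEQ_realpow_zero[rotated])
  have Bad_meas: "Bad K \<in> events" for K
  proof -
    have m: "{\<omega> \<in> space M. (-1) ^ i * (B (a l + (real i + 1) * (R l / N)) \<omega> - B (a l) \<omega>) < R l} \<in> events" if "i < N" for l i
    proof -
      have "(real i + 1) * (R l / N) \<le> real N * (R l / N)" using that hN[of l] by (intro mult_right_mono) auto
      then have "(real i + 1) * (R l / N) \<le> R l" using N by simp
      moreover have "0 \<le> (real i + 1) * (R l / N)" using hN[of l] by (intro mult_nonneg_nonneg) auto
      ultimately have [measurable]: "B (a l + (real i + 1) * (R l / N)) \<in> borel_measurable M" "B (a l) \<in> borel_measurable M"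
        using a0[of l] a1[of l] R[of l] by (auto intro!: B_measurable simp del: times_divide_eq_right)
      show ?thesis by measurable
    qed
    have "{\<omega> \<in> space M. \<exists>i\<in>{..<N}. (-1) ^ i * (B (a l + (real i + 1) * (R l / N)) \<omega> - B (a l) \<omega>) < R l} \<in> events" for l
      by (rule sets.sets_Collect_finite_Ex) (auto intro: m simp del: times_divide_eq_right)
    then have "{\<omega> \<in> space M. \<forall>l\<in>{..<K}. \<exists>i\<in>{..<N}. (-1) ^ i * (B (a l + (real i + 1) * (R l / N)) \<omega> - B (a l) \<omega>) < R l} \<in> events"
      by (intro sets.sets_Collect_finite_All) auto
    then show ?thesis by (simp only: Bad_def Ball_def Bex_def lessThan_iff)
  qed
  define Z where "Z = (\<Inter>K. Bad K)"
  have Z: "Z \<in> events" unfolding Z_def using Bad_meas by auto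
  have "prob Z \<le> q ^ K" for K
  proof -
    have "prob Z \<le> prob (Bad K)" using Bad_meas by (intro finite_measure_mono) (auto simp: Z_def)
    then show ?thesis using Bad[of K] by simp
  qed
  then have "prob Z \<le> 0" by (intro LIMSEQ_le_const[OF lim]) auto
  then have "prob Z = 0" by (simp add: measure_le_0_iff)
  then have "AE \<omega> in M. \<omega> \<notin> Z" using Z by (simp add: prob_eq_0)
  with AE_space show ?thesis
  proof eventually_elim
    case (elim \<omega>)
    then obtain K where "\<omega> \<notin> Bad K" by (auto simp: Z_def)
    then obtain l where "\<forall>i<N. \<not> (-1) ^ i * (B (a l + (real i + 1) * (R l / N)) \<omega> - B (a l) \<omega>) < R l"
      using elim(1) unfolding Bad_def by blast
    then have "\<forall>i<N. R l \<le> (-1) ^ i * (B (a l + (real i + 1) * (R l / N)) \<omega> - B (a l) \<omega>)"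
      unfolding not_less .
    then show ?case using R[of l] a0[of l] a1[of l] by blast
  qed
qed

end

theorem theorem3p3:
  fixes M :: "'a measure"
    and W B :: "real \<Rightarrow> 'a \<Rightarrow> real"
    and f f' :: "real \<Rightarrow> real"
    and J :: "real set"
  assumes "wiener_process M W"
    and "finite {x. f x = 0}"
    and "is_interval J" and "interior J \<noteq> {}"
    and "continuous_on J f"
    and "\<And>x. x \<in> J \<Longrightarrow> (f has_real_derivative f' x) (at x within J)"
    and "continuous_on J f'"
    and "\<And>t. t \<in> {0..1} \<Longrightarrow> is_ito_integral M W t (\<lambda>x \<omega>. f x) (B t)"
    and "AE \<omega> in M. continuous_on {0..1} (\<lambda>t. B t \<omega>)"
  shows "AE \<omega> in M. assouad_dim (process_graph {0..1} (\<lambda>t. B t \<omega>)) = 2"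
proof -
  interpret wiener_integral_process M W f B
    using assms(1,8) by unfold_locales
  \<comment> \<open>One null set serves all the countably many \<open>n\<close>. The number of
    columns is even because the counting argument takes every second one.\<close>
  have "AE \<omega> in M. \<forall>n. 0 < n \<longrightarrow> (\<exists>a R. 0 < R \<and> 0 \<le> a \<and> a + R \<le> 1 \<and>
    (\<forall>i<2 * n. (-1) ^ i * (B (a + (real i + 1) * (R / real (2 * n))) \<omega> - B a \<omega>) \<ge> R))"
    unfolding AE_all_countable using AE_oscillation[OF _ assms(2), of "2 * _"]
    by (auto simp del: of_nat_mult)
  with assms(9) show ?thesis
  proof eventually_elim
    case (elim \<omega>)
    show ?case by (rule assouad_dim_oscillating_graph[OF elim(1)]) (use elim(2) in simp)
  qed
qed

end
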